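(* There is an absolute constant $C>0$ such that the following holds. Let $a\ge 1$ be an integer, let $J<R$ be integers with $J\ge\log_2(2a)$, put $N=2^R$, let $M\ge N$ be an integer and let $\epsilon\in(0,1]$. Let $\{\varphi_{n_1,n_2}\}_{0\le n_1,n_2\le N-1}$ be the basis of $\mathcal W_{N^2}$ formed by the first $N\times N$ two-dimensional boundary-corrected Daubechies scaling functions and wavelets on $[0,1]^2$ with $a$ vanishing moments and coarsest scale $J$, let $I_M=\{-\lceil M/2\rceil,\dots,\lceil M/2\rceil-1\}$, and let $$G^{[N^2,M^2]}:\mathbb C^{N\times N}\to\mathbb C^{I_M\times I_M},\qquad \alpha\mapsto\Big(\epsilon\,\Big\langle \sum_{n_1,n_2=0}^{N-1}\alpha_{n_1,n_2}\varphi_{n_1,n_2},\,e_{\epsilon m_1}\otimes e_{\epsilon m_2}\Big\rangle\Big)_{m_1,m_2\in I_M}.$$ Then each of the two maps $\alpha\mapsto G^{[N^2,M^2]}(\alpha)$ and $\zeta\mapsto (G^{[N^2,M^2]})^*(\zeta)$ can be computed with at most $$C\,\big(aM^2+M^2\log(N/\epsilon)\big)$$ arithmetic operations.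
   Context: Inner product and exponentials: $\langle f,g\rangle=\int_{[0,1]^2}f\,\overline{g}$ on $L^2([0,1]^2)$; $e_\omega(x)=e^{2\pi i\omega x}\chi_{[0,1]}(x)$ for $\omega\in\mathbb R$, and $(e_{\omega_1}\otimes e_{\omega_2})(x_1,x_2)=e_{\omega_1}(x_1)e_{\omega_2}(x_2)$. The adjoint is the conjugate transpose with respect to the standard inner products on $\mathbb C^{N\times N}$ and $\mathbb C^{I_M\times I_M}$. One-dimensional boundary-corrected Daubechies wavelets (the Cohen--Daubechies--Vial construction on the interval): $\phi$ and $\psi$ are the Daubechies scaling function and wavelet with $a$ vanishing moments, supported in $[-a+1,a]$; $\phi^0_k,\psi^0_k$ and $\phi^1_k,\psi^1_k$ ($k=0,\dots,a-1$) are the compactly supported boundary scaling functions and boundary wavelets at the left and right endpoints. For $2^j\ge 2a$ and $x\in[0,1]$, $$\phi^{[0,1]}_{j,k}(x)=\begin{cases}2^{j/2}\phi^0_k(2^jx),&0\le k<a,\\ 2^{j/2}\phi(2^jx-k),&a\le k<2^j-a,\\ 2^{j/2}\phi^1_{2^j-k-1}(2^j(x-1)),&2^j-a\le k<2^j,\end{cases}$$ and $\psi^{[0,1]}_{j,k}$ is defined analogously from $\psi,\psi^0_k,\psi^1_k$. Let $V_j=\mathrm{span}\{\phi^{[0,1]}_{j,k}:0\le k<2^j\}$ and $W_j=\mathrm{span}\{\psi^{[0,1]}_{j,k}:0\le k<2^j\}$. Standard properties: for $2^j\ge 2a$ the families $\{\phi^{[0,1]}_{j,k}\}_k$ and $\{\psi^{[0,1]}_{j,k}\}_k$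 are orthonormal, $V_{j+1}=V_j\oplus W_j$ (orthogonal sum), and each $\phi^{[0,1]}_{j,k}$ and $\psi^{[0,1]}_{j,k}$ is a linear combination of the functions $\phi^{[0,1]}_{j+1,l}$ with at most $3a-1$ nonzero (known) filter coefficients. Two-dimensional basis: for $0\le k_1,k_2<2^j$ put $\Phi_{j,(k_1,k_2)}=\phi^{[0,1]}_{j,k_1}\otimes\phi^{[0,1]}_{j,k_2}$, $\Psi^1_{j,(k_1,k_2)}=\phi^{[0,1]}_{j,k_1}\otimes\psi^{[0,1]}_{j,k_2}$, $\Psi^2_{j,(k_1,k_2)}=\psi^{[0,1]}_{j,k_1}\otimes\phi^{[0,1]}_{j,k_2}$, $\Psi^3_{j,(k_1,k_2)}=\psi^{[0,1]}_{j,k_1}\otimes\psi^{[0,1]}_{j,k_2}$. The family $\{\varphi_{n_1,n_2}\}_{0\le n_1,n_2\le N-1}$, $N=2^R$, is the orthonormal family $\{\Phi_{J,(k_1,k_2)}\}\cup\{\Psi^i_{j,(k_1,k_2)}:i=1,2,3,\ J\le j\le R-1\}$ arranged as an $N\times N$ array in the usual order of increasing scale: the $2^J\times2^J$ top-left block holds the $\Phi_{J,\cdot}$, and for each $j$ the $\Psi^1_{j,\cdot},\Psi^2_{j,\cdot},\Psi^3_{j,\cdot}$ fill respectively the top-right, bottom-left and bottom-right $2^j\times 2^j$ blocks of the top-left $2^{j+1}\times2^{j+1}$ subarray. Its span is $\mathcal W_{N^2}=\mathrm{span}\{\Phi_{R,(k_1,k_2)}:0\le k_1,k_2<N\}$.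 Cost model: the cost of computing a linear map is the number of additions, subtractions and multiplications of complex numbers performed by a straight-line program (arithmetic circuit) that takes the entries of the input array and outputs the entries of the image array. All constants independent of the input are regarded as precomputed and free; these include the wavelet filter coefficients, roots of unity, and values of the Fourier transforms of $\phi,\phi^0_k,\phi^1_k$ at the points $\epsilon m/N$. *)

theory Defs
  imports "HOL-Analysis.Analysis" "HOL-Library.Discrete_Functions"
begin

section \<open>Daubechies scaling functions and wavelets\<close>

text \<open>
  Elements of $L^2$ are represented by Borel functions, and all identities between them are
  required almost everywhere. In the following definition, the refinement filter \<open>h\<close> has length
  \<open>2 a\<close>, the integer translates of \<open>phi\<close> are orthonormal and \<open>psi\<close> has \<open>a\<close> vanishing moments;
  this is the Daubechies condition (maximal number of vanishing moments for the filter length)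
  and determines \<open>h\<close> up to the choice of the spectral factor.
\<close>

definition daubechies :: "nat \<Rightarrow> (real \<Rightarrow> real) \<Rightarrow> (real \<Rightarrow> real) \<Rightarrow> bool" where
  "daubechies a phi psi \<longleftrightarrow>
     phi \<in> borel_measurable borel \<and> psi \<in> borel_measurable borel \<and>
     integrable lborel (\<lambda>x. (phi x)\<^sup>2) \<and>
     (AE x in lborel. x \<notin> {1 - real a..real a} \<longrightarrow> phi x = 0 \<and> psi x = 0) \<and>
     (LINT x|lborel. phi x) = 1 \<and>
     (\<forall>k::int. (LINT x|lborel. phi x * phi (x - of_int k)) = of_bool (k = 0)) \<and>
     (\<exists>h :: int \<Rightarrow> real.
        (AE x in lborel. phi x =
           sqrt 2 * (\<Sum>k\<in>{1 - int a..int a}. h k * phi (2 * x - of_int k))) \<and>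
        (AE x in lborel. psi x =
           sqrt 2 * (\<Sum>k\<in>{1 - int a..int a}.
             (-1) powi k * h (1 - k) * phi (2 * x - of_int k)))) \<and>
     (\<forall>l<a. (LINT x|lborel. x ^ l * psi x) = 0)"


section \<open>Boundary functions of Cohen, Daubechies and Vial\<close>

definition orthonormal_on :: "real set \<Rightarrow> nat \<Rightarrow> (nat \<Rightarrow> real \<Rightarrow> real) \<Rightarrow> bool" where
  "orthonormal_on X n f \<longleftrightarrow>
     (\<forall>k<n. \<forall>l<n. (LINT x:X|lborel. f k x * f l x) = of_bool (k = l))"

text \<open>
  On the half-line $[0,\infty)$ the functions \<open>edge_fun a phi k\<close>, \<open>k < a\<close>, together with the
  translates \<open>phi (x - m)\<close>, \<open>m \<ge> a\<close>, generate the polynomials of degree less than \<open>a\<close>.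
\<close>

definition edge_fun :: "nat \<Rightarrow> (real \<Rightarrow> real) \<Rightarrow> nat \<Rightarrow> real \<Rightarrow> real" where
  "edge_fun a phi k x =
     (\<Sum>n = k..2 * a - 2. real (n choose k) * phi (x + real n - real a + 1))"

text \<open>
  The boundary scaling functions orthonormalise the edge functions on the half-line; Gram-Schmidt
  in any order is a special case. The boundary wavelets are an orthonormal basis of the complement
  (which has dimension \<open>a\<close>) of the interior wavelets in $V_1 \ominus V_0$ on the half-line. The
  range of \<open>m\<close> expresses support in \<open>[0, 2 a - 1]\<close>.
\<close>

definition left_boundary ::
  "nat \<Rightarrow> (real \<Rightarrow> real) \<Rightarrow> (real \<Rightarrow> real) \<Rightarrow> (nat \<Rightarrow> real \<Rightarrow> real) \<Rightarrow> (nat \<Rightarrow> real \<Rightarrow> real) \<Rightarrow> bool"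
  where
  "left_boundary a phi psi bphi bpsi \<longleftrightarrow>
     (\<forall>k<a. bphi k \<in> borel_measurable borel \<and> bpsi k \<in> borel_measurable borel) \<and>
     (\<exists>c :: nat \<Rightarrow> nat \<Rightarrow> real. \<forall>k<a. AE x in lborel. x \<ge> 0 \<longrightarrow>
        bphi k x = (\<Sum>n<a. c k n * edge_fun a phi n x)) \<and>
     orthonormal_on {0..} a bphi \<and>
     (\<exists>G g :: nat \<Rightarrow> nat \<Rightarrow> real. \<forall>k<a. AE x in lborel. x \<ge> 0 \<longrightarrow>
        bpsi k x = sqrt 2 * (\<Sum>l<a. G k l * bphi l (2 * x)) +
          sqrt 2 * (\<Sum>m = a..3 * a - 2. g k m * phi (2 * x - real m))) \<and>
     orthonormal_on {0..} a bpsi \<and>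
     (\<forall>k<a. \<forall>l<a. (LINT x:{0..}|lborel. bpsi k x * bphi l x) = 0) \<and>
     (\<forall>k<a. \<forall>m\<ge>a. (LINT x:{0..}|lborel. bpsi k x * phi (x - real m)) = 0 \<and>
                   (LINT x:{0..}|lborel. bpsi k x * psi (x - real m)) = 0)"

text \<open>
  \<open>phi0\<close>, \<open>psi0\<close> and \<open>phi1\<close>, \<open>psi1\<close> are the boundary functions at the left and right endpoints;
  the latter live on $(-\infty, 0]$.
\<close>

record wavelet_system =
  phi :: "real \<Rightarrow> real"
  psi :: "real \<Rightarrow> real"
  phi0 :: "nat \<Rightarrow> real \<Rightarrow> real"
  psi0 :: "nat \<Rightarrow> real \<Rightarrow> real"
  phi1 :: "nat \<Rightarrow> real \<Rightarrow> real"
  psi1 :: "nat \<Rightarrow> real \<Rightarrow> real"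

definition phi_int :: "nat \<Rightarrow> wavelet_system \<Rightarrow> nat \<Rightarrow> nat \<Rightarrow> real \<Rightarrow> real" where
  "phi_int a S j k x =
     2 powr (real j / 2) *
     (if k < a then phi0 S k (2 ^ j * x)
      else if k < 2 ^ j - a then phi S (2 ^ j * x - real k)
      else phi1 S (2 ^ j - k - 1) (2 ^ j * (x - 1)))"

definition psi_int :: "nat \<Rightarrow> wavelet_system \<Rightarrow> nat \<Rightarrow> nat \<Rightarrow> real \<Rightarrow> real" where
  "psi_int a S j k x =
     2 powr (real j / 2) *
     (if k < a then psi0 S k (2 ^ j * x)
      else if k < 2 ^ j - a then psi S (2 ^ j * x - real k)
      else psi1 S (2 ^ j - k - 1) (2 ^ j * (x - 1)))"

definition span01 :: "nat \<Rightarrow> (nat \<Rightarrow> real \<Rightarrow> real) \<Rightarrow> (real \<Rightarrow> complex) set" where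
  "span01 n f =
     {u. \<exists>c :: nat \<Rightarrow> complex. AE x in lborel. x \<in> {0..1} \<longrightarrow>
           u x = (\<Sum>k<n. c k * of_real (f k x))}"

definition V_space :: "nat \<Rightarrow> wavelet_system \<Rightarrow> nat \<Rightarrow> (real \<Rightarrow> complex) set" where
  "V_space a S j = span01 (2 ^ j) (phi_int a S j)"

definition W_space :: "nat \<Rightarrow> wavelet_system \<Rightarrow> nat \<Rightarrow> (real \<Rightarrow> complex) set" where
  "W_space a S j = span01 (2 ^ j) (psi_int a S j)"

definition filtered_by :: "(real \<Rightarrow> real) \<Rightarrow> nat \<Rightarrow> nat \<Rightarrow> (nat \<Rightarrow> real \<Rightarrow> real) \<Rightarrow> bool" where
  "filtered_by u s n f \<longleftrightarrow>
     (\<exists>h :: nat \<Rightarrow> real. card {l. l < n \<and> h l \<noteq> 0} \<le> s \<and>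
        (AE x in lborel. x \<in> {0..1} \<longrightarrow> u x = (\<Sum>l<n. h l * f l x)))"

text \<open>The standard properties of the construction at scale \<open>j\<close>, valid whenever $2^j \ge 2a$.\<close>

definition multiresolution :: "nat \<Rightarrow> wavelet_system \<Rightarrow> nat \<Rightarrow> bool" where
  "multiresolution a S j \<longleftrightarrow>
     orthonormal_on {0..1} (2 ^ j) (phi_int a S j) \<and>
     orthonormal_on {0..1} (2 ^ j) (psi_int a S j) \<and>
     (\<forall>k<2 ^ j. \<forall>l<2 ^ j.
        (LINT x:{0..1}|lborel. phi_int a S j k x * psi_int a S j l x) = 0) \<and>
     V_space a S (Suc j) =
       {(\<lambda>x. u x + w x) | u w. u \<in> V_space a S j \<and> w \<in> W_space a S j} \<and>
     (\<forall>k<2 ^ j.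
        filtered_by (phi_int a S j k) (3 * a - 1) (2 ^ Suc j) (phi_int a S (Suc j)) \<and>
        filtered_by (psi_int a S j k) (3 * a - 1) (2 ^ Suc j) (phi_int a S (Suc j)))"

text \<open>
  The reflection \<open>\<lambda>x. phi (1 - x)\<close> is again supported in \<open>[1 - a, a]\<close> and refinable, and it
  turns the right endpoint into the left one.
\<close>

definition cdv_wavelets :: "nat \<Rightarrow> wavelet_system \<Rightarrow> bool" where
  "cdv_wavelets a S \<longleftrightarrow>
     daubechies a (phi S) (psi S) \<and>
     left_boundary a (phi S) (psi S) (phi0 S) (psi0 S) \<and>
     left_boundary a (\<lambda>x. phi S (1 - x)) (\<lambda>x. psi S (1 - x))
       (\<lambda>k x. phi1 S k (- x)) (\<lambda>k x. psi1 S k (- x)) \<and>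
     (\<forall>j. 2 * a \<le> 2 ^ j \<longrightarrow> multiresolution a S j)"


section \<open>The two-dimensional basis and the sampling operator\<close>

definition tensor :: "(real \<Rightarrow> 'c::times) \<Rightarrow> (real \<Rightarrow> 'c) \<Rightarrow> real \<times> real \<Rightarrow> 'c" where
  "tensor f g = (\<lambda>(x1, x2). f x1 * g x2)"

text \<open>
  Entry \<open>(n1, n2)\<close> of the array, \<open>n1\<close> being the row: for \<open>2 ^ j \<le> max n1 n2 < 2 ^ (j + 1)\<close> with
  \<open>j \<ge> J\<close> it belongs to the top-right, bottom-left or bottom-right block of scale \<open>j\<close>.
\<close>

definition wavelet2d :: "nat \<Rightarrow> wavelet_system \<Rightarrow> nat \<Rightarrow> nat \<Rightarrow> nat \<Rightarrow> real \<times> real \<Rightarrow> real" where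
  "wavelet2d a S J n1 n2 =
     (if max n1 n2 < 2 ^ J then tensor (phi_int a S J n1) (phi_int a S J n2)
      else let j = floor_log (max n1 n2) in
        if n1 < 2 ^ j then tensor (phi_int a S j n1) (psi_int a S j (n2 - 2 ^ j))
        else if n2 < 2 ^ j then tensor (psi_int a S j (n1 - 2 ^ j)) (phi_int a S j n2)
        else tensor (psi_int a S j (n1 - 2 ^ j)) (psi_int a S j (n2 - 2 ^ j)))"

definition inner01 :: "(real \<times> real \<Rightarrow> complex) \<Rightarrow> (real \<times> real \<Rightarrow> complex) \<Rightarrow> complex" where
  "inner01 f g = (LINT x:{0..1} \<times> {0..1}|lborel. f x * cnj (g x))"

definition fexp :: "real \<Rightarrow> real \<Rightarrow> complex" where
  "fexp \<omega> x = exp (2 * of_real pi * \<i> * of_real \<omega> * of_real x) * indicator {0..1} x"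

definition freqs :: "nat \<Rightarrow> int set" where
  "freqs M = {- \<lceil>real M / 2\<rceil> .. \<lceil>real M / 2\<rceil> - 1}"

definition sampling ::
  "nat \<Rightarrow> wavelet_system \<Rightarrow> nat \<Rightarrow> nat \<Rightarrow> real \<Rightarrow> (nat \<times> nat \<Rightarrow> complex) \<Rightarrow> (int \<times> int \<Rightarrow> complex)"
  where
  "sampling a S J N \<epsilon> \<alpha> = (\<lambda>(m1, m2).
     of_real \<epsilon> *
     inner01 (\<lambda>x. \<Sum>n1<N. \<Sum>n2<N. \<alpha> (n1, n2) * of_real (wavelet2d a S J n1 n2 x))
       (tensor (fexp (\<epsilon> * of_int m1)) (fexp (\<epsilon> * of_int m2))))"

definition adjoint_map ::
  "'o set \<Rightarrow> (('i \<Rightarrow> complex) \<Rightarrow> ('o \<Rightarrow> complex)) \<Rightarrow> ('o \<Rightarrow> complex) \<Rightarrow> ('i \<Rightarrow> complex)" where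
  "adjoint_map Y F \<zeta> = (\<lambda>i. \<Sum>y\<in>Y. cnj (F (\<lambda>i'. of_bool (i' = i)) y) * \<zeta> y)"


section \<open>Straight-line programs over the complex numbers\<close>

datatype 'i operand = Input 'i | Constant complex | Register nat

datatype operation = Add | Sub | Mul

text \<open>Instruction number \<open>k\<close> of a program stores its result in register \<open>k\<close>.\<close>

type_synonym 'i program = "(operation \<times> 'i operand \<times> 'i operand) list"

primrec operand_val :: "('i \<Rightarrow> complex) \<Rightarrow> complex list \<Rightarrow> 'i operand \<Rightarrow> complex" where
  "operand_val \<alpha> rs (Input i) = \<alpha> i"
| "operand_val \<alpha> rs (Constant c) = c"
| "operand_val \<alpha> rs (Register k) = rs ! k"

primrec apply_operation :: "operation \<Rightarrow> complex \<Rightarrow> complex \<Rightarrow> complex" where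
  "apply_operation Add x y = x + y"
| "apply_operation Sub x y = x - y"
| "apply_operation Mul x y = x * y"

definition run :: "('i \<Rightarrow> complex) \<Rightarrow> 'i program \<Rightarrow> complex list" where
  "run \<alpha> P =
     foldl (\<lambda>rs (f, u, v). rs @ [apply_operation f (operand_val \<alpha> rs u) (operand_val \<alpha> rs v)]) [] P"

primrec operand_ok :: "'i set \<Rightarrow> nat \<Rightarrow> 'i operand \<Rightarrow> bool" where
  "operand_ok X n (Input i) = (i \<in> X)"
| "operand_ok X n (Constant c) = True"
| "operand_ok X n (Register k) = (k < n)"

definition program_ok :: "'i set \<Rightarrow> 'i program \<Rightarrow> bool" where
  "program_ok X P \<longleftrightarrow>
     (\<forall>k<length P. case P ! k of (f, u, v) \<Rightarrow> operand_ok X k u \<and> operand_ok X k v)"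

text \<open>
  \<open>F\<close> maps arrays indexed by \<open>X\<close> to arrays indexed by \<open>Y\<close>, and \<open>out\<close> says where each output
  entry is found. Only the instructions are counted; constants are free.
\<close>

definition computable_within ::
  "'i set \<Rightarrow> 'o set \<Rightarrow> (('i \<Rightarrow> complex) \<Rightarrow> ('o \<Rightarrow> complex)) \<Rightarrow> real \<Rightarrow> bool" where
  "computable_within X Y F b \<longleftrightarrow>
     (\<exists>(P :: 'i program) (out :: 'o \<Rightarrow> 'i operand).
        program_ok X P \<and> (\<forall>y\<in>Y. operand_ok X (length P) (out y)) \<and>
        (\<forall>\<alpha>. \<forall>y\<in>Y. operand_val \<alpha> (run \<alpha> P) (out y) = F \<alpha> y) \<and>
        real (length P) \<le> b)"

end

theory Submission
  imports Defs
begin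

text \<open>
  The sampling matrix is a product of sparse matrices. The number of nonzero entries of a factor
  bounds its cost and that of its adjoint, so one factorisation serves both maps.
  One wavelet level in one of the two coordinates is a factor with at most \<open>3 a\<close> entries per
  column. At the finest scale the matrix is a tensor square, and the one-dimensional matrix has
  entries $g(m) e^{i \theta m k}$ except in at most \<open>2 a\<close> boundary columns. The exponential
  matrix is cut into blocks of \<open>N\<close> consecutive frequencies, each of which is a Toeplitz matrix
  between diagonal ones (chirp transform). Frequencies are never identified modulo $N / \epsilon$,
  so no integrality of $1 / \epsilon$ is needed, and each one-dimensional transform costs
  $O(a M + M \log N)$.
\<close>


section \<open>Joint computation by straight-line programs\<close>

text \<open>Three sources of cost must be kept apart. The filters contribute a factor
  \<open>a\<close> per column, and a plain count over all levels would give \<open>a\<close> times a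
  logarithm. Level \<open>j\<close> filters only the top-left square of side
  \<open>2 ^ (j + 1)\<close>, so these costs form a geometric sum of order \<open>a * 4 ^ R\<close>;
  the untouched columns cost order \<open>4 ^ R\<close> per level and belong to the logarithmic
  term. Filtering both coordinates in a single factor would put the square of \<open>a\<close> into
  the bound. The boundary columns are simply dense: they cost order \<open>a * M\<close> in one
  dimension, and the tensor square multiplies this by a length of order \<open>M\<close>. The
  parameter \<epsilon> changes the constants of the programs but not the sizes of the factors; the
  recursion depth is governed by \<open>R\<close>, and \<open>ln N\<close> is at most
  \<open>ln (N / \<epsilon>)\<close>. The twist in the circulant matrices makes their class closed
  under halving. Transform, product and inverse transform thus become one induction on the size,
  with square roots as precomputed constants.\<close>

definition jointly_computable :: "'i set \<Rightarrow> real \<Rightarrow> (('i \<Rightarrow> complex) \<Rightarrow> complex) set \<Rightarrow> bool" where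
  "jointly_computable X b T \<longleftrightarrow>
     (\<exists>P. program_ok X P \<and> real (length P) \<le> b \<and>
        (\<forall>f\<in>T. \<exists>u. operand_ok X (length P) u \<and> (\<forall>\<alpha>. operand_val \<alpha> (run \<alpha> P) u = f \<alpha>)))"

lemma run_Nil [simp]: "run \<alpha> [] = []"
  by (simp add: run_def)

lemma run_snoc:
  "run \<alpha> (P @ [(f, u, v)]) =
     run \<alpha> P @ [apply_operation f (operand_val \<alpha> (run \<alpha> P) u) (operand_val \<alpha> (run \<alpha> P) v)]"
  by (simp add: run_def)

lemma length_run [simp]: "length (run \<alpha> P) = length P"
proof (induction P rule: rev_induct)
  case (snoc i P)
  then show ?case by (cases i) (simp add: run_snoc)
qed simp

lemma program_ok_snoc:
  "program_ok X (P @ [(f, u, v)]) \<longleftrightarrow>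
     program_ok X P \<and> operand_ok X (length P) u \<and> operand_ok X (length P) v"
  by (auto simp: program_ok_def nth_append less_Suc_eq)

lemma operand_ok_mono: "operand_ok X n u \<Longrightarrow> n \<le> n' \<Longrightarrow> operand_ok X n' u"
  by (cases u) auto

lemma operand_val_append:
  "operand_ok X (length rs) u \<Longrightarrow> operand_val \<alpha> (rs @ rs') u = operand_val \<alpha> rs u"
  by (cases u) (auto simp: nth_append)

section \<open>Splicing one program behind another\<close>

primrec substitute :: "('j \<Rightarrow> 'i operand) \<Rightarrow> nat \<Rightarrow> 'j operand \<Rightarrow> 'i operand" where
  "substitute w n (Input y) = w y"
| "substitute w n (Constant c) = Constant c"
| "substitute w n (Register k) = Register (n + k)"

abbreviation substitute_program :: "('j \<Rightarrow> 'i operand) \<Rightarrow> nat \<Rightarrow> 'j program \<Rightarrow> 'i program" where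
  "substitute_program w n \<equiv> map (\<lambda>(f, u, v). (f, substitute w n u, substitute w n v))"

lemma operand_ok_substitute:
  assumes "operand_ok Y k u" and "\<And>y. y \<in> Y \<Longrightarrow> operand_ok X n (w y)"
  shows "operand_ok X (n + k) (substitute w n u)"
  using assms by (cases u) (auto intro: operand_ok_mono[OF assms(2)])

lemma operand_val_substitute:
  assumes "operand_ok Y k u"
    and "\<And>y. y \<in> Y \<Longrightarrow> operand_ok X (length rs) (w y) \<and> operand_val \<alpha> rs (w y) = \<beta> y"
  shows "operand_val \<alpha> (rs @ rs') (substitute w (length rs) u) = operand_val \<beta> rs' u"
  using assms by (cases u) (auto simp: operand_val_append[of X])

text \<open>Each input of \<open>Q\<close> is replaced by an operand of \<open>P\<close> that
  already holds its value, and the registers of \<open>Q\<close> are shifted past those of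
  \<open>P\<close>. The array \<alpha> is fixed here, since \<beta> is what \<open>P\<close>
  produces from it.\<close>

lemma run_substitute:
  assumes "program_ok Y Q" and "program_ok X P"
    and w: "\<And>y. y \<in> Y \<Longrightarrow>
      operand_ok X (length P) (w y) \<and> operand_val \<alpha> (run \<alpha> P) (w y) = \<beta> y"
  shows "program_ok X (P @ substitute_program w (length P) Q) \<and>
    run \<alpha> (P @ substitute_program w (length P) Q) = run \<alpha> P @ run \<beta> Q"
  using assms(1)
proof (induction Q rule: rev_induct)
  case Nil
  then show ?case using assms(2) by simp
next
  case (snoc i Q)
  obtain f u v where i: "i = (f, u, v)" by (cases i)
  let ?P' = "P @ substitute_program w (length P) Q"
  have ok: "program_ok Y Q" "operand_ok Y (length Q) u" "operand_ok Y (length Q) v"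
    using snoc.prems by (auto simp: i program_ok_snoc)
  have IH: "program_ok X ?P'" "run \<alpha> ?P' = run \<alpha> P @ run \<beta> Q"
    using snoc.IH[OF ok(1)] by auto
  have val: "operand_val \<alpha> (run \<alpha> ?P') (substitute w (length P) z) = operand_val \<beta> (run \<beta> Q) z"
    if "operand_ok Y (length Q) z" for z
    using operand_val_substitute[OF that, of X "run \<alpha> P" w \<alpha> \<beta> "run \<beta> Q"] w IH(2) by simp
  have okz: "operand_ok X (length ?P') (substitute w (length P) z)"
    if "operand_ok Y (length Q) z" for z
    using operand_ok_substitute[OF that, of X "length P" w] w by simp
  have eq: "P @ substitute_program w (length P) (Q @ [i]) =
      ?P' @ [(f, substitute w (length P) u, substitute w (length P) v)]"
    by (simp add: i)
  have "program_ok X (?P' @ [(f, substitute w (length P) u, substitute w (length P) v)])"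
    unfolding program_ok_snoc using IH(1) okz ok by blast
  moreover have "run \<alpha> (?P' @ [(f, substitute w (length P) u, substitute w (length P) v)]) =
      run \<alpha> P @ run \<beta> (Q @ [i])"
    unfolding i run_snoc val[OF ok(2)] val[OF ok(3)] unfolding IH(2) by (rule append_assoc)
  ultimately show ?case unfolding eq by (rule conjI)
qed

text \<open>The second program reads values of functionals in \<open>T\<close> as its inputs.
  \<open>T\<close> is kept in the result, so that intermediate values stay available to later
  instructions without being recomputed.\<close>

lemma jointly_computable_seq:
  assumes P: "jointly_computable X b T" and Q: "jointly_computable Y c U"
    and g: "\<And>y. y \<in> Y \<Longrightarrow> g y \<in> T"
  shows "jointly_computable X (b + c) (T \<union> (\<lambda>u \<alpha>. u (\<lambda>y. g y \<alpha>)) ` U)"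
proof -
  obtain P where P: "program_ok X P" "real (length P) \<le> b"
    "\<And>f. f \<in> T \<Longrightarrow> \<exists>u. operand_ok X (length P) u \<and> (\<forall>\<alpha>. operand_val \<alpha> (run \<alpha> P) u = f \<alpha>)"
    using P unfolding jointly_computable_def by blast
  obtain Q where Q: "program_ok Y Q" "real (length Q) \<le> c"
    "\<And>f. f \<in> U \<Longrightarrow> \<exists>u. operand_ok Y (length Q) u \<and> (\<forall>\<alpha>. operand_val \<alpha> (run \<alpha> Q) u = f \<alpha>)"
    using Q unfolding jointly_computable_def by blast
  have "\<forall>y\<in>Y. \<exists>u. operand_ok X (length P) u \<and> (\<forall>\<alpha>. operand_val \<alpha> (run \<alpha> P) u = g y \<alpha>)"
    using P(3) g by blast
  then obtain w where w: "\<And>y. y \<in> Y \<Longrightarrow>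
      operand_ok X (length P) (w y) \<and> (\<forall>\<alpha>. operand_val \<alpha> (run \<alpha> P) (w y) = g y \<alpha>)"
    by metis
  define P' where "P' = P @ substitute_program w (length P) Q"
  have P': "program_ok X P'" "run \<alpha> P' = run \<alpha> P @ run (\<lambda>y. g y \<alpha>) Q" for \<alpha>
    using run_substitute[OF Q(1) P(1), of w \<alpha> "\<lambda>y. g y \<alpha>" for \<alpha>] w unfolding P'_def by blast+
  have len: "length P' = length P + length Q" by (simp add: P'_def)
  have "\<exists>u. operand_ok X (length P') u \<and> (\<forall>\<alpha>. operand_val \<alpha> (run \<alpha> P') u = f \<alpha>)"
    if "f \<in> T \<union> (\<lambda>u \<alpha>. u (\<lambda>y. g y \<alpha>)) ` U" for f
    using that
  proof
    assume "f \<in> T"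
    then obtain u where "operand_ok X (length P) u" "\<And>\<alpha>. operand_val \<alpha> (run \<alpha> P) u = f \<alpha>"
      using P(3) by blast
    then show ?thesis
      by (intro exI[of _ u]) (auto simp: len P'(2) operand_val_append[of X] intro: operand_ok_mono)
  next
    assume "f \<in> (\<lambda>u \<alpha>. u (\<lambda>y. g y \<alpha>)) ` U"
    then obtain h where h: "h \<in> U" and f: "f = (\<lambda>\<alpha>. h (\<lambda>y. g y \<alpha>))" by blast
    obtain u where u: "operand_ok Y (length Q) u" "\<And>\<alpha>. operand_val \<alpha> (run \<alpha> Q) u = h \<alpha>"
      using Q(3)[OF h] by blast
    have "operand_val \<alpha> (run \<alpha> P') (substitute w (length P) u) = f \<alpha>" for \<alpha>
      using operand_val_substitute[OF u(1), of X "run \<alpha> P" w \<alpha> "\<lambda>y. g y \<alpha>"] w u(2)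
      by (simp add: P'(2) f)
    moreover have "operand_ok X (length P') (substitute w (length P) u)"
      unfolding len using u(1) w by (intro operand_ok_substitute) auto
    ultimately show ?thesis by blast
  qed
  moreover have "real (length P') \<le> b + c" using P(2) Q(2) by (simp add: len)
  ultimately show ?thesis unfolding jointly_computable_def using P'(1) by blast
qed

lemma jointly_computable_mono:
  "jointly_computable X b T \<Longrightarrow> b \<le> b' \<Longrightarrow> T' \<subseteq> T \<Longrightarrow> jointly_computable X b' T'"
  unfolding jointly_computable_def by (meson order_trans subsetD)

text \<open>The empty program suffices, because inputs and constants are operands and not
  instructions. This is how coefficients are supplied below at no cost.\<close>

lemma jointly_computable_free:
  "jointly_computable X 0 ((\<lambda>x \<alpha>. \<alpha> x) ` X \<union> range (\<lambda>c \<alpha>. c))"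
proof -
  have "\<exists>u. operand_ok X 0 u \<and> (\<forall>\<alpha>. operand_val \<alpha> [] u = f \<alpha>)"
    if "f \<in> (\<lambda>x \<alpha>. \<alpha> x) ` X \<union> range (\<lambda>c \<alpha>. c)" for f
    using that
  proof
    assume "f \<in> (\<lambda>x \<alpha>. \<alpha> x) ` X"
    then obtain x where "x \<in> X" "f = (\<lambda>\<alpha>. \<alpha> x)" by blast
    then show ?thesis by (intro exI[of _ "Input x"]) auto
  next
    assume "f \<in> range (\<lambda>c \<alpha>. c)"
    then obtain c where "f = (\<lambda>\<alpha>. c)" by blast
    then show ?thesis by (intro exI[of _ "Constant c"]) auto
  qed
  then show ?thesis
    unfolding jointly_computable_def by (intro exI[of _ "[]"]) (auto simp: program_ok_def)
qed

lemma jointly_computable_union: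
  assumes "jointly_computable X b T" "jointly_computable X c U"
  shows "jointly_computable X (b + c) (T \<union> U)"
proof -
  let ?F = "(\<lambda>x \<alpha>. \<alpha> x) ` X \<union> range (\<lambda>c \<alpha>. c)"
  \<comment> \<open>The raw inputs must be among the available functionals before the second program
    can be spliced in with the identity substitution.\<close>
  have 1: "jointly_computable X (0 + b) (?F \<union> (\<lambda>u \<alpha>. u (\<lambda>y. \<alpha> y)) ` T)"
    by (rule jointly_computable_seq[OF jointly_computable_free assms(1)]) auto
  have "jointly_computable X (0 + b + c)
      ((?F \<union> (\<lambda>u \<alpha>. u (\<lambda>y. \<alpha> y)) ` T) \<union> (\<lambda>u \<alpha>. u (\<lambda>y. \<alpha> y)) ` U)"
    by (rule jointly_computable_seq[OF 1 assms(2)]) auto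
  then show ?thesis by (rule jointly_computable_mono) auto
qed

lemma jointly_computable_operation:
  assumes T: "jointly_computable X b T" and "f \<in> T" "g \<in> T"
  shows "jointly_computable X (b + 1) (insert (\<lambda>\<alpha>. apply_operation p (f \<alpha>) (g \<alpha>)) T)"
proof -
  \<comment> \<open>The instruction alone is a program over the two inputs \<open>True\<close> and
    \<open>False\<close>, which is spliced behind the given one.\<close>
  let ?h = "\<lambda>\<beta>. apply_operation p (\<beta> True) (\<beta> False)"
  have "jointly_computable (UNIV :: bool set) 1 {?h}"
    unfolding jointly_computable_def
    by (intro exI[of _ "[(p, Input True, Input False)]"])
      (auto simp: program_ok_def run_def intro!: exI[of _ "Register 0"])
  then have "jointly_computable X (b + 1)
      (T \<union> (\<lambda>u \<alpha>. u (\<lambda>y. (if y then f else g) \<alpha>)) ` {?h})"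
    using assms(2,3) by (intro jointly_computable_seq[OF T]) auto
  then show ?thesis by (rule jointly_computable_mono) auto
qed

text \<open>Each term takes one multiplication by a free constant and one addition; the sum starts
  from the constant 0.\<close>

lemma jointly_computable_linear_combination:
  assumes "jointly_computable X b T" and "finite K" and "f ` K \<subseteq> T"
  shows "jointly_computable X (b + 2 * real (card K)) (insert (\<lambda>\<alpha>. \<Sum>k\<in>K. a k * f k \<alpha>) T)"
  using assms(2,3)
proof (induction K rule: finite_induct)
  case empty
  have "jointly_computable X (b + 0) (T \<union> ((\<lambda>x \<alpha>. \<alpha> x) ` X \<union> range (\<lambda>c \<alpha>. c)))"
    by (intro jointly_computable_union assms jointly_computable_free)
  then show ?case by (rule jointly_computable_mono) auto
next
  case (insert k K)
  let ?s = "\<lambda>\<alpha>. \<Sum>k\<in>K. a k * f k \<alpha>"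
  have "jointly_computable X (b + 2 * real (card K) + 0)
      (Set.insert ?s T \<union> ((\<lambda>x \<alpha>. \<alpha> x) ` X \<union> range (\<lambda>c \<alpha>. c)))"
    using insert by (intro jointly_computable_union jointly_computable_free) auto
  then have 1: "jointly_computable X (b + 2 * real (card K))
      (Set.insert (\<lambda>\<alpha>. a k) (Set.insert ?s T))"
    by (rule jointly_computable_mono) auto
  have 2: "jointly_computable X (b + 2 * real (card K) + 1)
      (Set.insert (\<lambda>\<alpha>. a k * f k \<alpha>) (Set.insert (\<lambda>\<alpha>. a k) (Set.insert ?s T)))"
    using jointly_computable_operation[OF 1, of "\<lambda>\<alpha>. a k" "f k" Mul] insert.prems by auto
  show ?case
    using jointly_computable_operation[OF 2, of "\<lambda>\<alpha>. a k * f k \<alpha>" ?s Add]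
    by (rule jointly_computable_mono) (use insert in auto)
qed

lemma jointly_computable_linear_family:
  assumes T: "jointly_computable X b T" and "finite Y"
    and "\<And>y. y \<in> Y \<Longrightarrow> finite (K y)" and "\<And>y k. y \<in> Y \<Longrightarrow> k \<in> K y \<Longrightarrow> f y k \<in> T"
  shows "jointly_computable X (b + (\<Sum>y\<in>Y. 2 * real (card (K y))))
    (T \<union> (\<lambda>y \<alpha>. \<Sum>k\<in>K y. a y k * f y k \<alpha>) ` Y)"
  using assms(2-)
proof (induction Y rule: finite_induct)
  case empty
  then show ?case using T by simp
next
  case (insert y Y)
  have "jointly_computable X (b + (\<Sum>y\<in>Y. 2 * real (card (K y))) + 2 * real (card (K y)))
      (Set.insert (\<lambda>\<alpha>. \<Sum>k\<in>K y. a y k * f y k \<alpha>)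
        (T \<union> (\<lambda>y \<alpha>. \<Sum>k\<in>K y. a y k * f y k \<alpha>) ` Y))"
    using insert by (intro jointly_computable_linear_combination) auto
  then show ?case
    by (rule jointly_computable_mono) (use insert in auto)
qed

lemma jointly_computable_Union:
  assumes "finite I" and "\<And>i. i \<in> I \<Longrightarrow> jointly_computable X (b i) (T i)"
  shows "jointly_computable X (\<Sum>i\<in>I. b i) (\<Union>i\<in>I. T i)"
  using assms
proof (induction I rule: finite_induct)
  case empty
  show ?case using jointly_computable_free[of X] by (rule jointly_computable_mono) auto
next
  case (insert i I)
  have "jointly_computable X (b i + (\<Sum>i\<in>I. b i)) (T i \<union> (\<Union>i\<in>I. T i))"
    using insert by (intro jointly_computable_union) auto
  then show ?case by (rule jointly_computable_mono) (use insert in auto)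
qed

lemma computable_withinI:
  assumes "jointly_computable X b ((\<lambda>y \<alpha>. F \<alpha> y) ` Y)"
  shows "computable_within X Y F b"
proof -
  obtain P where P: "program_ok X P" "real (length P) \<le> b"
    "\<forall>f\<in>(\<lambda>y \<alpha>. F \<alpha> y) ` Y.
       \<exists>u. operand_ok X (length P) u \<and> (\<forall>\<alpha>. operand_val \<alpha> (run \<alpha> P) u = f \<alpha>)"
    using assms unfolding jointly_computable_def by blast
  then have "\<forall>y\<in>Y. \<exists>u. operand_ok X (length P) u \<and> (\<forall>\<alpha>. operand_val \<alpha> (run \<alpha> P) u = F \<alpha> y)"
    by simp
  then obtain out where "\<forall>y\<in>Y. operand_ok X (length P) (out y) \<and>
      (\<forall>\<alpha>. operand_val \<alpha> (run \<alpha> P) (out y) = F \<alpha> y)"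
    by metis
  then show ?thesis unfolding computable_within_def using P by blast
qed


section \<open>Matrices that are cheap together with their adjoints\<close>

definition linear_forms ::
  "'i set \<Rightarrow> 'o set \<Rightarrow> ('o \<Rightarrow> 'i \<Rightarrow> complex) \<Rightarrow> (('i \<Rightarrow> complex) \<Rightarrow> complex) set" where
  "linear_forms X Y A = (\<lambda>y \<alpha>. \<Sum>x\<in>X. A y x * \<alpha> x) ` Y"

definition adjoint :: "('o \<Rightarrow> 'i \<Rightarrow> complex) \<Rightarrow> 'i \<Rightarrow> 'o \<Rightarrow> complex" where
  "adjoint A = (\<lambda>x y. cnj (A y x))"

text \<open>Both directions share one bound \<open>b\<close>. All constructions below preserve this
  symmetric notion, so the adjoint never needs an algorithm of its own.\<close>

definition matrix_cost :: "'i set \<Rightarrow> 'o set \<Rightarrow> ('o \<Rightarrow> 'i \<Rightarrow> complex) \<Rightarrow> real \<Rightarrow> bool" where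
  "matrix_cost X Y A b \<longleftrightarrow> finite X \<and> finite Y \<and>
     jointly_computable X b (linear_forms X Y A) \<and>
     jointly_computable Y b (linear_forms Y X (adjoint A))"

lemma linear_forms_cong:
  "(\<And>x y. x \<in> X \<Longrightarrow> y \<in> Y \<Longrightarrow> A y x = B y x) \<Longrightarrow> linear_forms X Y A = linear_forms X Y B"
  unfolding linear_forms_def by (intro image_cong refl ext sum.cong) auto

lemma matrix_cost_mono: "matrix_cost X Y A b \<Longrightarrow> b \<le> c \<Longrightarrow> matrix_cost X Y A c"
  unfolding matrix_cost_def by (blast intro: jointly_computable_mono)

lemma matrix_cost_cong:
  assumes "matrix_cost X Y A b" "\<And>x y. x \<in> X \<Longrightarrow> y \<in> Y \<Longrightarrow> A y x = B y x"
  shows "matrix_cost X Y B b"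
  using assms linear_forms_cong[of X Y A B] linear_forms_cong[of Y X "adjoint A" "adjoint B"]
  by (simp add: matrix_cost_def adjoint_def)

lemma linear_forms_sparse:
  assumes "finite X" "finite Y"
  shows "jointly_computable X (\<Sum>y\<in>Y. 2 * real (card {x \<in> X. A y x \<noteq> 0})) (linear_forms X Y A)"
proof -
  have "jointly_computable X (0 + (\<Sum>y\<in>Y. 2 * real (card {x \<in> X. A y x \<noteq> 0})))
      (((\<lambda>x \<alpha>. \<alpha> x) ` X \<union> range (\<lambda>c \<alpha>. c)) \<union>
        (\<lambda>y \<alpha>. \<Sum>x\<in>{x \<in> X. A y x \<noteq> 0}. A y x * \<alpha> x) ` Y)"
    using assms by (intro jointly_computable_linear_family jointly_computable_free) auto
  moreover have "(\<Sum>x\<in>{x \<in> X. A y x \<noteq> 0}. A y x * \<alpha> x) = (\<Sum>x\<in>X. A y x * \<alpha> x)" for y \<alpha>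
    using assms by (intro sum.mono_neutral_left) auto
  ultimately show ?thesis
    unfolding linear_forms_def by (elim jointly_computable_mono) auto
qed

lemma sum_card_swap:
  assumes "finite X" "finite Y"
  shows "(\<Sum>y\<in>Y. card {x \<in> X. Q x y}) = (\<Sum>x\<in>X. card {y \<in> Y. Q x y})"
proof -
  have "(\<Sum>y\<in>Y. \<Sum>x\<in>X. of_bool (Q x y)) = (\<Sum>x\<in>X. \<Sum>y\<in>Y. of_bool (Q x y) :: nat)"
    by (rule sum.swap)
  then show ?thesis using assms by (simp add: Int_def sum.If_cases of_bool_def)
qed

text \<open>The map is charged by the rows of \<open>A\<close>, its adjoint by the columns. Counting
  the nonzero entries both ways gives the same number, so a bound on the columns controls both
  directions.\<close>

lemma matrix_cost_sparse:
  assumes "finite X" "finite Y" and s: "\<And>x. x \<in> X \<Longrightarrow> real (card {y \<in> Y. A y x \<noteq> 0}) \<le> s x"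
  shows "matrix_cost X Y A (2 * (\<Sum>x\<in>X. s x))"
proof -
  have le: "(\<Sum>x\<in>X. 2 * real (card {y \<in> Y. A y x \<noteq> 0})) \<le> 2 * (\<Sum>x\<in>X. s x)"
    unfolding sum_distrib_left by (intro sum_mono) (use s in auto)
  have "(\<Sum>y\<in>Y. 2 * real (card {x \<in> X. A y x \<noteq> 0})) = (\<Sum>x\<in>X. 2 * real (card {y \<in> Y. A y x \<noteq> 0}))"
    using arg_cong[OF sum_card_swap[OF assms(1,2), of "\<lambda>x y. A y x \<noteq> 0"], of "\<lambda>n. 2 * real n"]
    by (simp add: sum_distrib_left)
  then show ?thesis
    unfolding matrix_cost_def
    using assms(1,2) le linear_forms_sparse[OF assms(1,2), of A]
      linear_forms_sparse[OF assms(2,1), of "adjoint A"]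
    by (auto simp: adjoint_def elim!: jointly_computable_mono)
qed

lemma linear_forms_compose:
  assumes "finite X" and A: "jointly_computable X b (linear_forms X Y A)"
    and B: "jointly_computable Y c (linear_forms Y Z B)"
  shows "jointly_computable X (b + c) (linear_forms X Z (\<lambda>z x. \<Sum>y\<in>Y. B z y * A y x))"
proof -
  have "jointly_computable X (b + c) (linear_forms X Y A \<union>
      (\<lambda>u \<alpha>. u (\<lambda>y. \<Sum>x\<in>X. A y x * \<alpha> x)) ` linear_forms Y Z B)"
    using A B by (intro jointly_computable_seq) (auto simp: linear_forms_def)
  moreover have "(\<Sum>x\<in>X. (\<Sum>y\<in>Y. B z y * A y x) * \<alpha> x) = (\<Sum>y\<in>Y. B z y * (\<Sum>x\<in>X. A y x * \<alpha> x))"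
    for z \<alpha>
    unfolding sum_distrib_left sum_distrib_right
    by (subst sum.swap) (simp add: mult.assoc)
  ultimately show ?thesis
    by (elim jointly_computable_mono) (auto simp: linear_forms_def image_image)
qed

lemma matrix_cost_compose:
  assumes "matrix_cost X Y A b" "matrix_cost Y Z B c"
  shows "matrix_cost X Z (\<lambda>z x. \<Sum>y\<in>Y. B z y * A y x) (b + c)"
proof -
  have "jointly_computable Z (c + b)
      (linear_forms Z X (\<lambda>x z. \<Sum>y\<in>Y. adjoint A x y * adjoint B y z))"
    using assms by (intro linear_forms_compose) (auto simp: matrix_cost_def)
  moreover have "jointly_computable X (b + c) (linear_forms X Z (\<lambda>z x. \<Sum>y\<in>Y. B z y * A y x))"
    using assms by (intro linear_forms_compose) (auto simp: matrix_cost_def)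
  moreover have "(\<lambda>x z. \<Sum>y\<in>Y. adjoint A x y * adjoint B y z) =
      adjoint (\<lambda>z x. \<Sum>y\<in>Y. B z y * A y x)"
    by (simp add: adjoint_def mult.commute)
  ultimately show ?thesis using assms by (simp add: matrix_cost_def add.commute)
qed

lemma linear_forms_add:
  assumes "finite Y" and A: "jointly_computable X b (linear_forms X Y A)"
    and B: "jointly_computable X c (linear_forms X Y B)"
  shows "jointly_computable X (b + c + 4 * real (card Y)) (linear_forms X Y (\<lambda>y x. A y x + B y x))"
proof -
  let ?f = "\<lambda>y k. if k then (\<lambda>\<alpha>. \<Sum>x\<in>X. A y x * \<alpha> x) else (\<lambda>\<alpha>. \<Sum>x\<in>X. B y x * \<alpha> x)"
  have "jointly_computable X (b + c + (\<Sum>y\<in>Y. 2 * real (card (UNIV :: bool set))))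
      ((linear_forms X Y A \<union> linear_forms X Y B) \<union> (\<lambda>y \<alpha>. \<Sum>k\<in>UNIV. 1 * ?f y k \<alpha>) ` Y)"
    using assms by (intro jointly_computable_linear_family jointly_computable_union)
      (auto simp: linear_forms_def)
  then show ?thesis
    by (rule jointly_computable_mono)
      (auto simp: linear_forms_def UNIV_bool algebra_simps sum.distrib)
qed

text \<open>Adding two forms is a linear combination with two unit coefficients, hence costs 4. The
  map has its outputs in \<open>Y\<close> and the adjoint has them in \<open>X\<close>, so both
  cardinalities occur.\<close>

lemma matrix_cost_add:
  assumes "matrix_cost X Y A b" "matrix_cost X Y B c"
  shows "matrix_cost X Y (\<lambda>y x. A y x + B y x) (b + c + 4 * (real (card X) + real (card Y)))"
proof -
  have "jointly_computable X (b + c + 4 * real (card Y)) (linear_forms X Y (\<lambda>y x. A y x + B y x))"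
    using assms by (intro linear_forms_add) (auto simp: matrix_cost_def)
  moreover have "jointly_computable Y (b + c + 4 * real (card X))
      (linear_forms Y X (\<lambda>x y. adjoint A x y + adjoint B x y))"
    using assms by (intro linear_forms_add) (auto simp: matrix_cost_def)
  moreover have "(\<lambda>x y. adjoint A x y + adjoint B x y) = adjoint (\<lambda>y x. A y x + B y x)"
    by (simp add: adjoint_def)
  ultimately show ?thesis
    using assms by (auto simp: matrix_cost_def elim!: jointly_computable_mono)
qed

text \<open>For a constant family this is the Kronecker product of an identity matrix with that
  matrix, which lets tensor products be applied one coordinate at a time.\<close>

definition block_diagonal :: "('k \<Rightarrow> 'o \<Rightarrow> 'i \<Rightarrow> complex) \<Rightarrow> 'k \<times> 'o \<Rightarrow> 'k \<times> 'i \<Rightarrow> complex" where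
  "block_diagonal A = (\<lambda>(i, y) (i', x). if i = i' then A i y x else 0)"

lemma sum_block_diagonal:
  assumes "finite I" "i \<in> I"
  shows "(\<Sum>p\<in>I \<times> X. block_diagonal A (i, y) p * f p) = (\<Sum>x\<in>X. A i y x * f (i, x))"
proof -
  have "(\<Sum>p\<in>I \<times> X. block_diagonal A (i, y) p * f p) =
      (\<Sum>i'\<in>I. \<Sum>x\<in>X. block_diagonal A (i, y) (i', x) * f (i', x))"
    by (simp add: sum.cartesian_product)
  also have "\<dots> = (\<Sum>i'\<in>I. if i = i' then \<Sum>x\<in>X. A i y x * f (i, x) else 0)"
    by (intro sum.cong) (auto simp: block_diagonal_def)
  finally show ?thesis using assms by simp
qed

lemma linear_forms_block_diagonal:
  assumes "finite I" and "\<And>i. i \<in> I \<Longrightarrow> jointly_computable X (c i) (linear_forms X Y (A i))"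
  shows "jointly_computable (I \<times> X) (\<Sum>i\<in>I. c i) (linear_forms (I \<times> X) (I \<times> Y) (block_diagonal A))"
proof -
  have "jointly_computable (I \<times> X) (0 + c i)
      (((\<lambda>x \<alpha>. \<alpha> x) ` (I \<times> X) \<union> range (\<lambda>c \<alpha>. c)) \<union>
        (\<lambda>u \<alpha>. u (\<lambda>x. \<alpha> (i, x))) ` linear_forms X Y (A i))" if "i \<in> I" for i
    using that assms by (intro jointly_computable_seq jointly_computable_free) auto
  then have "jointly_computable (I \<times> X) (\<Sum>i\<in>I. 0 + c i)
      (\<Union>i\<in>I. ((\<lambda>x \<alpha>. \<alpha> x) ` (I \<times> X) \<union> range (\<lambda>c \<alpha>. c)) \<union>
        (\<lambda>u \<alpha>. u (\<lambda>x. \<alpha> (i, x))) ` linear_forms X Y (A i))"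
    using assms by (intro jointly_computable_Union) auto
  then show ?thesis
  proof (rule jointly_computable_mono)
    show "linear_forms (I \<times> X) (I \<times> Y) (block_diagonal A) \<subseteq>
        (\<Union>i\<in>I. ((\<lambda>x \<alpha>. \<alpha> x) ` (I \<times> X) \<union> range (\<lambda>c \<alpha>. c)) \<union>
          (\<lambda>u \<alpha>. u (\<lambda>x. \<alpha> (i, x))) ` linear_forms X Y (A i))"
    proof
      fix f assume "f \<in> linear_forms (I \<times> X) (I \<times> Y) (block_diagonal A)"
      then obtain i y where iy: "i \<in> I" "y \<in> Y"
        "f = (\<lambda>\<alpha>. \<Sum>p\<in>I \<times> X. block_diagonal A (i, y) p * \<alpha> p)"
        by (auto simp: linear_forms_def)
      then have "f = (\<lambda>\<alpha>. \<Sum>x\<in>X. A i y x * \<alpha> (i, x))"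
        using assms(1) by (simp add: sum_block_diagonal)
      then have "f \<in> (\<lambda>u \<alpha>. u (\<lambda>x. \<alpha> (i, x))) ` linear_forms X Y (A i)"
        using iy by (auto simp: linear_forms_def)
      then show "f \<in> (\<Union>i\<in>I. ((\<lambda>x \<alpha>. \<alpha> x) ` (I \<times> X) \<union> range (\<lambda>c \<alpha>. c)) \<union>
          (\<lambda>u \<alpha>. u (\<lambda>x. \<alpha> (i, x))) ` linear_forms X Y (A i))"
        using iy(1) by blast
    qed
  qed auto
qed

lemma matrix_cost_block_diagonal:
  assumes "finite I" "finite X" "finite Y" and "\<And>i. i \<in> I \<Longrightarrow> matrix_cost X Y (A i) (c i)"
  shows "matrix_cost (I \<times> X) (I \<times> Y) (block_diagonal A) (\<Sum>i\<in>I. c i)"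
proof -
  have "jointly_computable (I \<times> Y) (\<Sum>i\<in>I. c i)
      (linear_forms (I \<times> Y) (I \<times> X) (block_diagonal (\<lambda>i. adjoint (A i))))"
    using assms by (intro linear_forms_block_diagonal) (auto simp: matrix_cost_def)
  moreover have "block_diagonal (\<lambda>i. adjoint (A i)) = adjoint (block_diagonal A)"
    by (auto simp: fun_eq_iff adjoint_def block_diagonal_def)
  ultimately show ?thesis
    using assms linear_forms_block_diagonal[of I X c Y A] by (auto simp: matrix_cost_def)
qed

text \<open>Relabelling the inputs only substitutes free operands and takes no instruction.\<close>

lemma linear_forms_reindex:
  assumes "bij_betw f X' X" "bij_betw g Y' Y" "jointly_computable X b (linear_forms X Y A)"
  shows "jointly_computable X' b (linear_forms X' Y' (\<lambda>y x. A (g y) (f x)))"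
proof -
  have inv: "inv_into X' f x \<in> X'" if "x \<in> X" for x
    using that assms(1) by (metis bij_betw_imp_surj_on inv_into_into)
  have "jointly_computable X' (0 + b)
      (((\<lambda>x \<alpha>. \<alpha> x) ` X' \<union> range (\<lambda>c \<alpha>. c)) \<union>
        (\<lambda>u \<alpha>. u (\<lambda>x. \<alpha> (inv_into X' f x))) ` linear_forms X Y A)"
    by (rule jointly_computable_seq[OF jointly_computable_free assms(3)]) (use inv in auto)
  then show ?thesis
  proof (rule jointly_computable_mono)
    have "(\<Sum>x\<in>X'. A (g y) (f x) * \<alpha> x) = (\<Sum>x\<in>X. A (g y) x * \<alpha> (inv_into X' f x))" for y \<alpha>
      using assms(1) by (simp add: sum.reindex_bij_betw[OF assms(1), symmetric] bij_betw_inv_into_left)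
    then show "linear_forms X' Y' (\<lambda>y x. A (g y) (f x)) \<subseteq>
        ((\<lambda>x \<alpha>. \<alpha> x) ` X' \<union> range (\<lambda>c \<alpha>. c)) \<union>
        (\<lambda>u \<alpha>. u (\<lambda>x. \<alpha> (inv_into X' f x))) ` linear_forms X Y A"
      using assms(2) by (auto simp: linear_forms_def bij_betw_def image_image)
  qed simp
qed

lemma matrix_cost_reindex:
  assumes "bij_betw f X' X" "bij_betw g Y' Y" "matrix_cost X Y A b"
  shows "matrix_cost X' Y' (\<lambda>y x. A (g y) (f x)) b"
  using assms linear_forms_reindex[of f X' X g Y' Y b A]
    linear_forms_reindex[of g Y' Y f X' X b "adjoint A"]
  by (auto simp: matrix_cost_def adjoint_def bij_betw_finite)

text \<open>Common shape of the two fast algorithms below: distribute the input to independent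
  blocks, treat each block, recombine. The halving step uses two blocks, the chirp transform one
  block per range of frequencies.\<close>

lemma matrix_cost_sandwich:
  assumes "finite I"
    and pre: "matrix_cost U (I \<times> X) B b"
    and mid: "\<And>i. i \<in> I \<Longrightarrow> matrix_cost X Y (A i) (c i)"
    and post: "matrix_cost (I \<times> Y) Z D d"
    and "finite X" "finite Y"
  shows "matrix_cost U Z (\<lambda>z u. \<Sum>i\<in>I. \<Sum>y\<in>Y. \<Sum>x\<in>X. D z (i, y) * A i y x * B (i, x) u)
    (b + (\<Sum>i\<in>I. c i) + d)"
proof (rule matrix_cost_cong)
  show "matrix_cost U Z (\<lambda>z u. \<Sum>q\<in>I \<times> Y. D z q * (\<Sum>p\<in>I \<times> X. block_diagonal A q p * B p u))
      (b + (\<Sum>i\<in>I. c i) + d)"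
    using assms by (intro matrix_cost_compose[OF matrix_cost_compose] matrix_cost_block_diagonal)
next
  fix u z
  have "(\<Sum>q\<in>I \<times> Y. D z q * (\<Sum>p\<in>I \<times> X. block_diagonal A q p * B p u)) =
      (\<Sum>i\<in>I. \<Sum>y\<in>Y. D z (i, y) * (\<Sum>p\<in>I \<times> X. block_diagonal A (i, y) p * B p u))"
    by (simp add: sum.cartesian_product)
  also have "\<dots> = (\<Sum>i\<in>I. \<Sum>y\<in>Y. \<Sum>x\<in>X. D z (i, y) * A i y x * B (i, x) u)"
    using assms(1) by (intro sum.cong refl)
      (simp add: sum_block_diagonal sum_distrib_left mult.assoc)
  finally show "(\<Sum>q\<in>I \<times> Y. D z q * (\<Sum>p\<in>I \<times> X. block_diagonal A q p * B p u)) =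
      (\<Sum>i\<in>I. \<Sum>y\<in>Y. \<Sum>x\<in>X. D z (i, y) * A i y x * B (i, x) u)" .
qed

text \<open>The tensor product factors as \<open>A\<close> on the first coordinate after
  \<open>B\<close> on the second. \<open>B\<close> is applied once for each first index in
  \<open>X\<close>, then \<open>A\<close> once for each second index in \<open>Y\<close>; swapping
  the coordinates makes the latter block diagonal.\<close>

lemma matrix_cost_tensor:
  assumes A: "matrix_cost X Y A b" and B: "matrix_cost X Y B c"
  shows "matrix_cost (X \<times> X) (Y \<times> Y) (\<lambda>(y1, y2) (x1, x2). A y1 x1 * B y2 x2)
    (real (card X) * c + real (card Y) * b)"
proof -
  have fin: "finite X" "finite Y" using A by (auto simp: matrix_cost_def)
  have 1: "matrix_cost (X \<times> X) (X \<times> Y) (block_diagonal (\<lambda>_. B)) (real (card X) * c)"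
    using matrix_cost_block_diagonal[of X X Y "\<lambda>_. B" "\<lambda>_. c"] fin B by simp
  have "matrix_cost (Y \<times> X) (Y \<times> Y) (block_diagonal (\<lambda>_. A)) (real (card Y) * b)"
    using matrix_cost_block_diagonal[of Y X Y "\<lambda>_. A" "\<lambda>_. b"] fin A by simp
  then have 2: "matrix_cost (X \<times> Y) (Y \<times> Y)
      (\<lambda>y x. block_diagonal (\<lambda>_. A) (prod.swap y) (prod.swap x)) (real (card Y) * b)"
    by (intro matrix_cost_reindex[of prod.swap _ _ prod.swap])
      (auto simp: bij_betw_def inj_on_def image_iff)
  show ?thesis
  proof (rule matrix_cost_cong[OF matrix_cost_compose[OF 1 2]], clarify)
    fix x1 x2 y1 y2 assume "x1 \<in> X" "x2 \<in> X" "y1 \<in> Y" "y2 \<in> Y"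
    have "(\<Sum>p\<in>X \<times> Y. block_diagonal (\<lambda>_. A) (prod.swap (y1, y2)) (prod.swap p) *
          block_diagonal (\<lambda>_. B) p (x1, x2)) =
        (\<Sum>x\<in>X. \<Sum>y\<in>Y. block_diagonal (\<lambda>_. A) (prod.swap (y1, y2)) (prod.swap (x, y)) *
          block_diagonal (\<lambda>_. B) (x, y) (x1, x2))"
      unfolding sum.cartesian_product by (intro sum.cong) auto
    also have "\<dots> = (\<Sum>x\<in>X. \<Sum>y\<in>Y. if x = x1 then if y2 = y then A y1 x1 * B y2 x2 else 0 else 0)"
      by (intro sum.cong) (auto simp: block_diagonal_def)
    also have "\<dots> = (\<Sum>x\<in>X. if x = x1 then A y1 x1 * B y2 x2 else 0)"
      using fin \<open>y2 \<in> Y\<close> by (intro sum.cong) auto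
    also have "\<dots> = A y1 x1 * B y2 x2"
      using fin \<open>x1 \<in> X\<close> by simp
    finally show "(\<Sum>p\<in>X \<times> Y. block_diagonal (\<lambda>_. A) (prod.swap (y1, y2)) (prod.swap p) *
          block_diagonal (\<lambda>_. B) p (x1, x2)) = A y1 x1 * B y2 x2" .
  qed
qed


section \<open>Twisted circulant matrices and the chirp transform\<close>

lemma sum_two_deltas:
  fixes F :: "nat \<Rightarrow> nat \<Rightarrow> complex"
  assumes "i < n" "j < n"
  shows "(\<Sum>y<n. \<Sum>x<n. (if y = i then p else 0) * F y x * (if x = j then q x else 0)) =
    p * F i j * q j"
proof -
  have "(\<Sum>y<n. \<Sum>x<n. (if y = i then p else 0) * F y x * (if x = j then q x else 0)) =
      (\<Sum>y<n. if y = i then \<Sum>x<n. if x = j then p * F i j * q j else 0 else 0)"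
    by (intro sum.cong) (auto simp: if_distrib[where f = "(*) c" for c] cong: if_cong)
  then show ?thesis using assms by simp
qed

text \<open>
  The matrix is a multiplication map of $\mathbb C[X]/(X^{2^r} - s)$, and with $t^2 = s$ this
  ring is the product of the rings with moduli $X^{2^{r-1}} - t$ and $X^{2^{r-1}} + t$.
\<close>

lemma matrix_cost_twisted_circulant:
  fixes u :: "int \<Rightarrow> complex"
  assumes "s \<noteq> 0" and "\<And>d. u (d - 2 ^ r) = s * u d"
  shows "matrix_cost {..<2 ^ r} {..<2 ^ r} (\<lambda>i j. u (int i - int j)) ((8 * real r + 2) * 2 ^ r)"
  using assms
proof (induction r arbitrary: s u)
  case 0
  have "matrix_cost {..<2 ^ 0} {..<2 ^ 0} (\<lambda>i j. u (int i - int j)) (2 * (\<Sum>x\<in>{..<2 ^ 0 :: nat}. 1))"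
  proof (rule matrix_cost_sparse)
    fix x :: nat
    have "card {y \<in> {..<2 ^ 0 :: nat}. u (int y - int x) \<noteq> 0} \<le> card {..<1::nat}"
      by (intro card_mono) auto
    then show "real (card {y \<in> {..<2 ^ 0 :: nat}. u (int y - int x) \<noteq> 0}) \<le> 1" by simp
  qed auto
  then show ?case by simp
next
  case (Suc r)
  define n :: nat where "n = 2 ^ r"
  have n: "n > 0" by (simp add: n_def)
  define t where "t = csqrt s"
  have t: "t \<noteq> 0" "t * t = s"
    using Suc.prems(1) by (auto simp: t_def power2_eq_square[symmetric])
  define sgn :: "bool \<Rightarrow> complex" where "sgn b = (if b then 1 else - 1)" for b
  \<comment> \<open>By the shift relation, \<open>u (d - int n) / t\<close> equals
    \<open>t * u (d + int n)\<close>. Hence \<open>v b\<close> lists the coefficients of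
    \<open>u\<close> reduced modulo $X^n - t$ or $X^n + t$, according to the sign
    \<open>sgn b\<close>.\<close>
  define v where "v b d = u d + sgn b * u (d - int n) / t" for b d
  have u_shift: "u (d - 2 * int n) = s * u d" for d
    using Suc.prems(2)[of d] by (simp add: n_def)
  have v_shift: "v b (d - 2 ^ r) = (sgn b * t) * v b d" for b d
  proof -
    have "d - int n - int n = d - 2 * int n" by simp
    then have "v b (d - int n) = u (d - int n) + sgn b * (s * u d) / t"
      unfolding v_def using u_shift[of d] by simp
    also have "\<dots> = (sgn b * t) * v b d"
      using t by (auto simp: v_def sgn_def field_simps)
    finally show ?thesis by (simp add: n_def)
  qed
  \<comment> \<open>Reduction of the input modulo the two factors: the power \<open>n + j\<close>
    becomes \<open>sgn b * t\<close> times the power \<open>j\<close>.\<close>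
  define B :: "bool \<times> nat \<Rightarrow> nat \<Rightarrow> complex" where
    "B = (\<lambda>(b, j) x. if j = x mod n then (if x < n then 1 else sgn b * t) else 0)"
  \<comment> \<open>Chinese remaindering: the low half is half the sum of the two residues, the high
    half is their difference divided by \<open>2 * t\<close>.\<close>
  define D :: "nat \<Rightarrow> bool \<times> nat \<Rightarrow> complex" where
    "D = (\<lambda>i (b, i'). if i' = i mod n then (if i < n then 1 / 2 else sgn b / (2 * t)) else 0)"
  have pre: "matrix_cost {..<2 * n} ((UNIV :: bool set) \<times> {..<n}) B (2 * (\<Sum>x\<in>{..<2 * n}. 2))"
  proof (rule matrix_cost_sparse)
    fix x
    have "card {p \<in> (UNIV :: bool set) \<times> {..<n}. B p x \<noteq> 0} \<le> card ((UNIV :: bool set) \<times> {x mod n})"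
      by (intro card_mono) (auto simp: B_def split: if_splits)
    then show "real (card {p \<in> (UNIV :: bool set) \<times> {..<n}. B p x \<noteq> 0}) \<le> 2"
      by (simp add: card_cartesian_product)
  qed auto
  have post: "matrix_cost ((UNIV :: bool set) \<times> {..<n}) {..<2 * n} D
      (2 * (\<Sum>x\<in>(UNIV :: bool set) \<times> {..<n}. 2))"
  proof (rule matrix_cost_sparse)
    fix p :: "bool \<times> nat"
    have "i = snd p \<or> i = snd p + n" if "i < 2 * n" "D i p \<noteq> 0" for i
    proof -
      have "snd p = i mod n" using that by (auto simp: D_def split: prod.splits if_splits)
      then show ?thesis
        using that(1) by (cases "i < n") (auto simp: le_mod_geq)
    qed
    then have "card {i \<in> {..<2 * n}. D i p \<noteq> 0} \<le> card {snd p, snd p + n}"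
      by (intro card_mono) auto
    also have "\<dots> \<le> 2" by (simp add: card_insert_if)
    finally show "real (card {i \<in> {..<2 * n}. D i p \<noteq> 0}) \<le> 2" by simp
  qed auto
  have mid: "matrix_cost {..<n} {..<n} (\<lambda>i j. v b (int i - int j)) ((8 * real r + 2) * 2 ^ r)" for b
    unfolding n_def using t v_shift by (intro Suc.IH[of "sgn b * t"]) (auto simp: sgn_def)
  have all: "matrix_cost {..<2 * n} {..<2 * n}
      (\<lambda>i x. \<Sum>b\<in>UNIV. \<Sum>y<n. \<Sum>x'<n. D i (b, y) * v b (int y - int x') * B (b, x') x)
      (2 * (\<Sum>x\<in>{..<2 * n}. 2) + (\<Sum>b\<in>(UNIV :: bool set). (8 * real r + 2) * 2 ^ r) +
       2 * (\<Sum>x\<in>(UNIV :: bool set) \<times> {..<n}. 2))"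
    by (intro matrix_cost_sandwich pre mid post) auto
  have entry: "(\<Sum>b\<in>UNIV. \<Sum>y<n. \<Sum>x'<n. D i (b, y) * v b (int y - int x') * B (b, x') x) =
      u (int i - int x)" if "i < 2 * n" "x < 2 * n" for i x
  proof -
    let ?d = "int (i mod n) - int (x mod n)"
    have "(\<Sum>b\<in>UNIV. \<Sum>y<n. \<Sum>x'<n. D i (b, y) * v b (int y - int x') * B (b, x') x) =
        (\<Sum>b\<in>UNIV. (if i < n then 1 / 2 else sgn b / (2 * t)) * v b ?d *
          (if x < n then 1 else sgn b * t))"
      unfolding B_def D_def using n by (intro sum.cong refl, simp only: prod.case)
        (subst sum_two_deltas, auto)
    also have "\<dots> = u (int i - int x)"
    proof -
      have i: "int (i mod n) = (if i < n then int i else int i - int n)"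
        using that by (auto simp: le_mod_geq)
      have x: "int (x mod n) = (if x < n then int x else int x - int n)"
        using that by (auto simp: le_mod_geq)
      have "u (int i - int n - int x - int n) = s * u (int i - int x)"
        using u_shift[of "int i - int x"] by (simp add: algebra_simps)
      then show ?thesis
        unfolding UNIV_bool using t unfolding i x v_def sgn_def
        by (auto simp: field_simps)
    qed
    finally show ?thesis .
  qed
  have "matrix_cost {..<2 * n} {..<2 * n} (\<lambda>i j. u (int i - int j))
      (2 * (\<Sum>x\<in>{..<2 * n}. 2) + (\<Sum>b\<in>(UNIV :: bool set). (8 * real r + 2) * 2 ^ r) +
       2 * (\<Sum>x\<in>(UNIV :: bool set) \<times> {..<n}. 2))"
    by (rule matrix_cost_cong[OF all]) (use entry in auto)
  \<comment> \<open>\<open>B\<close> and \<open>D\<close> have at most \<open>4 * n\<close> nonzero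
    entries each and cost \<open>8 * n\<close> each. The recursion that doubles the cost at size
    \<open>n\<close> and adds \<open>16 * n\<close> is solved by the factor 8; the summand 2 is the
    cost of a single entry.\<close>
  then have "matrix_cost {..<2 * n} {..<2 * n} (\<lambda>i j. u (int i - int j))
      ((8 * real (Suc r) + 2) * 2 ^ Suc r)"
    by (rule matrix_cost_mono) (simp add: n_def card_cartesian_product algebra_simps)
  then show ?case by (simp add: n_def)
qed

lemma ceiling_half_le: "2 * \<lceil>real M / 2\<rceil> \<le> int M + 1"
  by linarith

lemma finite_freqs [simp]: "finite (freqs M)"
  by (simp add: freqs_def)

lemma card_freqs_le: "1 \<le> M \<Longrightarrow> real (card (freqs M)) \<le> 2 * real M"
  using ceiling_half_le[of M] by (auto simp: freqs_def)

text \<open>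
  Bluestein's identity \<open>2 i k = i\<^sup>2 + k\<^sup>2 - (i - k)\<^sup>2\<close> turns the evaluation on \<open>2 ^ R\<close> consecutive
  frequencies into a Toeplitz product; \<open>freqs M\<close> is cut into such blocks.
\<close>

lemma matrix_cost_chirp:
  fixes \<theta> :: real and g :: "int \<Rightarrow> complex"
  assumes "2 ^ R \<le> M"
  shows "matrix_cost {..<2 ^ R} (freqs M) (\<lambda>m k. g m * cis (\<theta> * of_int m * real k))
    ((32 * real R + 52) * real M)"
proof -
  define n :: nat where "n = 2 ^ R"
  have n: "n > 0" "n \<le> M" using assms by (auto simp: n_def)
  define h where "h = \<lceil>real M / 2\<rceil>"
  define \<mu> where "\<mu> m = nat (m + h)" for m
  have \<mu>: "int (\<mu> m) = m + h" "\<mu> m \<le> M" if "m \<in> freqs M" for m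
    using that ceiling_half_le[of M] by (auto simp: \<mu>_def freqs_def h_def)
  \<comment> \<open>For odd \<open>M\<close> the shifted index \<mu> attains the value
    \<open>M\<close>, so the block containing \<open>M\<close> must be included. Since
    \<open>n\<close> is at most \<open>M\<close>, the blocks have total length at most
    \<open>2 * M\<close>.\<close>
  define q where "q = M div n + 1"
  have qn: "q * n \<le> 2 * M"
    using n(2) div_times_less_eq_dividend[of M n] unfolding q_def distrib_right mult_1 by linarith
  have \<mu>q: "\<mu> m div n < q" if "m \<in> freqs M" for m
    using \<mu>[OF that] by (simp add: q_def div_le_mono less_Suc_eq_le)
  \<comment> \<open>The chirp itself is not periodic, but the Toeplitz block only uses differences
    of absolute value below \<open>n\<close>. Each difference is replaced by its representative
    between \<open>- n\<close> and \<open>n - 1\<close> modulo \<open>2 * n\<close>, which embeds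
    the block into a circulant of twice the size.\<close>
  define u where
    "u d = cis (- \<theta> / 2 * (of_int ((d + int n) mod (2 * int n) - int n))\<^sup>2)" for d
  have u_eq: "u d = cis (- \<theta> / 2 * (of_int d)\<^sup>2)" if "\<bar>d\<bar> < int n" for d
    using that by (simp add: u_def mod_pos_pos_trivial)
  have u_period: "u (d - 2 ^ Suc R) = 1 * u d" for d
  proof -
    have "(d - 2 * int n + int n) mod (2 * int n) = (d + int n) mod (2 * int n)"
      using mod_add_self2[of "d - int n" "2 * int n"] by (simp add: algebra_simps)
    then show ?thesis by (simp add: u_def n_def)
  qed
  \<comment> \<open>With \<open>m = b * n - h + i\<close>, the block offset contributes a phase that
    depends on \<open>k\<close> alone; it joins the factor for the square of \<open>k\<close>.
    Indices from \<open>n\<close> on are zero padding.\<close>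
  define B :: "nat \<times> nat \<Rightarrow> nat \<Rightarrow> complex" where
    "B = (\<lambda>(b, j) k. if j = k
       then cis (\<theta> * (of_int (int (b * n) - h)) * real k + \<theta> / 2 * (real k)\<^sup>2) else 0)"
  define D :: "int \<Rightarrow> nat \<times> nat \<Rightarrow> complex" where
    "D = (\<lambda>m (b, i). if b = \<mu> m div n \<and> i = \<mu> m mod n
       then g m * cis (\<theta> / 2 * (real i)\<^sup>2) else 0)"
  have pre: "matrix_cost {..<n} ({..<q} \<times> {..<2 * n}) B (2 * (\<Sum>x\<in>{..<n}. real q))"
  proof (rule matrix_cost_sparse)
    fix k
    have "card {p \<in> {..<q} \<times> {..<2 * n}. B p k \<noteq> 0} \<le> card ({..<q} \<times> {k})"
      by (intro card_mono) (auto simp: B_def split: if_splits)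
    then show "real (card {p \<in> {..<q} \<times> {..<2 * n}. B p k \<noteq> 0}) \<le> real q"
      by (simp add: card_cartesian_product)
  qed auto
  have post: "matrix_cost ({..<q} \<times> {..<2 * n}) (freqs M) D
      (2 * (\<Sum>x\<in>{..<q} \<times> {..<2 * n}. 1))"
  proof (rule matrix_cost_sparse)
    fix p :: "nat \<times> nat"
    have "m = int (fst p * n + snd p) - h" if "m \<in> freqs M" "D m p \<noteq> 0" for m
    proof -
      have "fst p = \<mu> m div n" "snd p = \<mu> m mod n"
        using that by (auto simp: D_def split: prod.splits if_splits)
      then have "fst p * n + snd p = \<mu> m" by simp
      then show ?thesis using \<mu>(1)[OF that(1)] by simp
    qed
    then have "card {m \<in> freqs M. D m p \<noteq> 0} \<le> card {int (fst p * n + snd p) - h}"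
      by (intro card_mono) auto
    then show "real (card {m \<in> freqs M. D m p \<noteq> 0}) \<le> 1" by simp
  qed auto
  have mid: "matrix_cost {..<2 * n} {..<2 * n} (\<lambda>i j. u (int i - int j))
      ((8 * real (Suc R) + 2) * 2 ^ Suc R)"
    using matrix_cost_twisted_circulant[of 1 u "Suc R", OF _ u_period] by (simp add: n_def)
  have all: "matrix_cost {..<n} (freqs M)
      (\<lambda>m k. \<Sum>b<q. \<Sum>y<2 * n. \<Sum>x<2 * n. D m (b, y) * u (int y - int x) * B (b, x) k)
      (2 * (\<Sum>x\<in>{..<n}. real q) + (\<Sum>b<q. (8 * real (Suc R) + 2) * 2 ^ Suc R) +
       2 * (\<Sum>x\<in>{..<q} \<times> {..<2 * n}. 1))"
    by (intro matrix_cost_sandwich pre mid post) auto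
  have entry: "(\<Sum>b<q. \<Sum>y<2 * n. \<Sum>x<2 * n. D m (b, y) * u (int y - int x) * B (b, x) k) =
      g m * cis (\<theta> * of_int m * real k)" if m: "m \<in> freqs M" and k: "k < n" for m k
  proof -
    define i where "i = \<mu> m mod n"
    define \<beta> where "\<beta> = \<mu> m div n"
    have i: "i < n" using n by (simp add: i_def)
    have m_eq: "m = int (\<beta> * n) - h + int i"
      using \<mu>(1)[OF m] by (metis add_diff_cancel_right' add_diff_eq diff_add_eq i_def \<beta>_def
          div_mult_mod_eq of_nat_add)
    let ?q = "\<lambda>b x. cis (\<theta> * (of_int (int (b * n) - h)) * real k + \<theta> / 2 * (real k)\<^sup>2)"
    have "(\<Sum>b<q. \<Sum>y<2 * n. \<Sum>x<2 * n. D m (b, y) * u (int y - int x) * B (b, x) k) =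
        (\<Sum>b<q. \<Sum>y<2 * n. \<Sum>x<2 * n.
          (if y = i then if b = \<beta> then g m * cis (\<theta> / 2 * (real i)\<^sup>2) else 0 else 0) *
          u (int y - int x) * (if x = k then ?q b x else 0))"
      by (intro sum.cong refl) (auto simp: D_def B_def i_def \<beta>_def)
    also have "\<dots> = (\<Sum>b<q. (if b = \<beta> then g m * cis (\<theta> / 2 * (real i)\<^sup>2) else 0) *
        u (int i - int k) * ?q b k)"
      using i k by (intro sum.cong refl sum_two_deltas) auto
    also have "\<dots> = (\<Sum>b<q. if b = \<beta> then g m * cis (\<theta> / 2 * (real i)\<^sup>2) *
        u (int i - int k) * ?q \<beta> k else 0)"
      by (intro sum.cong) auto
    also have "\<dots> = g m * cis (\<theta> / 2 * (real i)\<^sup>2) * u (int i - int k) * ?q \<beta> k"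
      using \<mu>q[OF m] by (simp add: \<beta>_def)
    also have "\<dots> = g m * cis (\<theta> / 2 * (real i)\<^sup>2 + - \<theta> / 2 * (of_int (int i - int k))\<^sup>2 +
        (\<theta> * (of_int (int (\<beta> * n) - h)) * real k + \<theta> / 2 * (real k)\<^sup>2))"
      using i k by (subst u_eq) (auto simp: cis_mult mult.assoc)
    also have "\<theta> / 2 * (real i)\<^sup>2 + - \<theta> / 2 * (of_int (int i - int k))\<^sup>2 +
        (\<theta> * (of_int (int (\<beta> * n) - h)) * real k + \<theta> / 2 * (real k)\<^sup>2) = \<theta> * of_int m * real k"
      unfolding m_eq by (simp add: field_simps power2_eq_square)
    finally show ?thesis .
  qed
  \<comment> \<open>Per block of length \<open>n\<close> the three factors contribute
    \<open>2 * n\<close>, \<open>(16 * R + 20) * n\<close> and \<open>4 * n\<close>.\<close>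
  have cost: "2 * (\<Sum>x\<in>{..<n}. real q) + (\<Sum>b<q. (8 * real (Suc R) + 2) * 2 ^ Suc R) +
      2 * (\<Sum>x\<in>{..<q} \<times> {..<2 * n}. 1) = (16 * real R + 26) * real (q * n)"
    by (simp add: card_cartesian_product n_def algebra_simps)
  also have "\<dots> \<le> (16 * real R + 26) * real (2 * M)"
    using qn by (intro mult_left_mono) (auto simp del: of_nat_mult)
  also have "\<dots> = (32 * real R + 52) * real M" by (simp add: algebra_simps)
  finally have "matrix_cost {..<n} (freqs M)
      (\<lambda>m k. \<Sum>b<q. \<Sum>y<2 * n. \<Sum>x<2 * n. D m (b, y) * u (int y - int x) * B (b, x) k)
      ((32 * real R + 52) * real M)"
    by (rule matrix_cost_mono[OF all])
  then show ?thesis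
    unfolding n_def[symmetric] by (rule matrix_cost_cong) (use entry in auto)
qed


section \<open>Fourier coefficients of the wavelet basis\<close>

definition fourier01 :: "(real \<Rightarrow> real) \<Rightarrow> real \<Rightarrow> complex" where
  "fourier01 f \<omega> = (LINT x:{0..1}|lborel. of_real (f x) * cnj (fexp \<omega> x))"

text \<open>Integrability is what linearity and Fubini require of the basis functions, because the
  exponentials are bounded by 1.\<close>

definition integrable01 :: "(real \<Rightarrow> real) \<Rightarrow> bool" where
  "integrable01 f \<longleftrightarrow> f \<in> borel_measurable borel \<and> set_integrable lborel {0..1} f"

lemma fexp_measurable [measurable]: "fexp \<omega> \<in> borel_measurable borel"
proof -
  have "continuous_on UNIV (\<lambda>x. exp (2 * of_real pi * \<i> * of_real \<omega> * complex_of_real x))"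
    by (intro continuous_intros)
  then have [measurable]:
    "(\<lambda>x. exp (2 * of_real pi * \<i> * of_real \<omega> * complex_of_real x)) \<in> borel_measurable borel"
    by (rule borel_measurable_continuous_onI)
  show ?thesis unfolding fexp_def by measurable
qed

lemma cnj_fexp_measurable [measurable]: "(\<lambda>x. cnj (fexp \<omega> x)) \<in> borel_measurable borel"
  using measurable_compose[OF fexp_measurable borel_measurable_continuous_onI[of cnj]]
  by (simp add: continuous_on_cnj)

lemma cnj_fexp: "0 \<le> x \<Longrightarrow> x \<le> 1 \<Longrightarrow> cnj (fexp \<omega> x) = cis (- (2 * pi * \<omega> * x))"
  by (simp add: fexp_def cis_conv_exp exp_cnj mult_ac)

lemma norm_fexp_le: "norm (fexp \<omega> x) \<le> 1"
  by (simp add: fexp_def norm_exp_eq_Re indicator_def)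

lemma set_integrable_fourier01:
  assumes "integrable01 f"
  shows "set_integrable lborel {0..1} (\<lambda>x. of_real (f x) * cnj (fexp \<omega> x))"
proof -
  have [measurable]: "f \<in> borel_measurable borel" using assms by (simp add: integrable01_def)
  have int: "set_integrable lborel {0..1} f" using assms by (simp add: integrable01_def)
  show ?thesis
    unfolding set_integrable_def
  proof (rule Bochner_Integration.integrable_bound)
    show "integrable lborel (\<lambda>x. indicator {0..1} x *\<^sub>R f x)"
      using int by (simp add: set_integrable_def)
    show "(\<lambda>x. indicator {0..1} x *\<^sub>R (complex_of_real (f x) * cnj (fexp \<omega> x)))
        \<in> borel_measurable lborel"
      by measurable
    have "norm (indicator {0..1} x *\<^sub>R (complex_of_real (f x) * cnj (fexp \<omega> x))) \<le>
        norm (indicator {0..1} x *\<^sub>R f x)" for x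
      using norm_fexp_le[of \<omega> x] by (auto simp: norm_mult indicator_def intro: mult_left_le)
    then show "AE x in lborel. norm (indicator {0..1} x *\<^sub>R (complex_of_real (f x) * cnj (fexp \<omega> x))) \<le>
        norm (indicator {0..1} x *\<^sub>R f x)" by simp
  qed
qed

text \<open>A Bochner integral has the default value 0 when the integrand is not integrable, so the
  value 1 forces the square to be integrable. The bound of the absolute value of \<open>f\<close> by
  \<open>1 + f * f\<close> on an interval of finite length gives the rest.\<close>

lemma integrable01_square:
  assumes [measurable]: "f \<in> borel_measurable borel"
    and "(LINT x:{0..1}|lborel. f x * f x) = 1"
  shows "integrable01 f"
proof -
  have sq: "set_integrable lborel {0..1} (\<lambda>x. f x * f x)"
    using assms(2) not_integrable_integral_eq[of lborel "\<lambda>x. indicator {0..1} x *\<^sub>R (f x * f x)"]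
    unfolding set_integrable_def set_lebesgue_integral_def by fastforce
  have "set_integrable lborel {0..1::real} (\<lambda>x. 1 + f x * f x)"
    by (intro set_integral_add sq) (auto simp: set_integrable_def)
  then have "set_integrable lborel {0..1} f"
    unfolding set_integrable_def
  proof (rule Bochner_Integration.integrable_bound)
    have "\<bar>t\<bar> \<le> 1 + t * t" for t :: real
      using zero_le_square[of "\<bar>t\<bar> - 1"] by (simp add: algebra_simps)
    moreover have "\<bar>1 + t * t\<bar> = 1 + t * t" for t :: real by simp
    ultimately show "AE x in lborel. norm (indicator {0..1} x *\<^sub>R f x) \<le>
        norm (indicator {0..1} x *\<^sub>R (1 + f x * f x))"
      by (auto simp: indicator_def)
  qed simp
  then show ?thesis by (simp add: integrable01_def)
qed

lemma fourier01_linear_combination: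
  assumes [measurable]: "u \<in> borel_measurable borel"
    and f: "\<And>l. l < n \<Longrightarrow> integrable01 (f l)"
    and ae: "AE x in lborel. x \<in> {0..1} \<longrightarrow> u x = (\<Sum>l<n. h l * f l x)"
  shows "fourier01 u \<omega> = (\<Sum>l<n. of_real (h l) * fourier01 (f l) \<omega>)"
proof -
  have [measurable]: "f l \<in> borel_measurable borel" if "l < n" for l
    using f[OF that] by (simp add: integrable01_def)
  have "fourier01 u \<omega> =
      (LINT x:{0..1}|lborel. \<Sum>l<n. of_real (h l) * (of_real (f l x) * cnj (fexp \<omega> x)))"
    unfolding fourier01_def
  proof (rule set_lebesgue_integral_cong_AE)
    have "AE x in lborel. x \<in> {0..1} \<longrightarrow> complex_of_real (u x) * cnj (fexp \<omega> x) =
        (\<Sum>l<n. of_real (h l) * (of_real (f l x) * cnj (fexp \<omega> x)))"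
      using ae by eventually_elim (simp add: sum_distrib_right mult.assoc)
    then show "AE x\<in>{0..1} in lborel. complex_of_real (u x) * cnj (fexp \<omega> x) =
        (\<Sum>l<n. of_real (h l) * (of_real (f l x) * cnj (fexp \<omega> x)))" .
  qed measurable
  also have "\<dots> = (\<Sum>l<n. LINT x:{0..1}|lborel. of_real (h l) * (of_real (f l x) * cnj (fexp \<omega> x)))"
    unfolding set_lebesgue_integral_def scaleR_sum_right
    using set_integrable_fourier01[OF f, of _ \<omega>]
    by (intro Bochner_Integration.integral_sum)
      (auto simp: set_integrable_def mult_scaleR_right[symmetric] simp del: mult_scaleR_right)
  also have "\<dots> = (\<Sum>l<n. of_real (h l) * fourier01 (f l) \<omega>)"
    by (simp add: fourier01_def)
  finally show ?thesis .
qed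

lemma product_integral:
  fixes F G :: "real \<Rightarrow> complex"
  assumes F: "integrable lborel F" and G: "integrable lborel G"
  shows "integrable lborel (\<lambda>p. F (fst p) * G (snd p))"
    and "(LINT p|lborel. F (fst p) * G (snd p)) = (LINT x|lborel. F x) * (LINT y|lborel. G y)"
proof -
  have [measurable]: "F \<in> borel_measurable borel" "G \<in> borel_measurable borel"
    using F G by (auto dest: borel_measurable_integrable)
  have int: "integrable (lborel \<Otimes>\<^sub>M lborel) (\<lambda>p. F (fst p) * G (snd p))"
  proof (rule lborel_pair.Fubini_integrable)
    show "integrable lborel (\<lambda>x. LINT y|lborel. norm (F (fst (x, y)) * G (snd (x, y))))"
      using F G by (simp add: norm_mult)
    show "AE x in lborel. integrable lborel (\<lambda>y. F (fst (x, y)) * G (snd (x, y)))"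
      using G by simp
  qed measurable
  then show "integrable lborel (\<lambda>p. F (fst p) * G (snd p))"
    by (simp add: lborel_prod)
  show "(LINT p|lborel. F (fst p) * G (snd p)) = (LINT x|lborel. F x) * (LINT y|lborel. G y)"
    using lborel_pair.integral_fst'[OF int] by (simp add: lborel_prod)
qed

lemma inner01_tensor_fexp:
  assumes "integrable01 f" "integrable01 g"
  shows "set_integrable lborel ({0..1} \<times> {0..1})
      (\<lambda>x. of_real (tensor f g x) * cnj (tensor (fexp \<omega>1) (fexp \<omega>2) x))"
    and "inner01 (\<lambda>x. of_real (tensor f g x)) (tensor (fexp \<omega>1) (fexp \<omega>2)) =
      fourier01 f \<omega>1 * fourier01 g \<omega>2"
proof -
  let ?F = "\<lambda>x. indicator {0..1} x *\<^sub>R (complex_of_real (f x) * cnj (fexp \<omega>1 x))"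
  let ?G = "\<lambda>x. indicator {0..1} x *\<^sub>R (complex_of_real (g x) * cnj (fexp \<omega>2 x))"
  have int: "integrable lborel ?F" "integrable lborel ?G"
    using assms set_integrable_fourier01 by (auto simp: set_integrable_def)
  have eq: "indicator ({0..1} \<times> {0..1}) p *\<^sub>R
      (complex_of_real (tensor f g p) * cnj (tensor (fexp \<omega>1) (fexp \<omega>2) p)) =
      ?F (fst p) * ?G (snd p)" for p
    by (cases p) (auto simp: tensor_def indicator_def)
  show "set_integrable lborel ({0..1} \<times> {0..1})
      (\<lambda>x. of_real (tensor f g x) * cnj (tensor (fexp \<omega>1) (fexp \<omega>2) x))"
    unfolding set_integrable_def eq using product_integral(1)[OF int] .
  show "inner01 (\<lambda>x. of_real (tensor f g x)) (tensor (fexp \<omega>1) (fexp \<omega>2)) =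
      fourier01 f \<omega>1 * fourier01 g \<omega>2"
    unfolding inner01_def fourier01_def set_lebesgue_integral_def eq
    using product_integral(2)[OF int] .
qed

lemma inner01_sum:
  assumes "finite K"
    and "\<And>k. k \<in> K \<Longrightarrow> set_integrable lborel ({0..1} \<times> {0..1}) (\<lambda>x. f k x * cnj (g x))"
  shows "inner01 (\<lambda>x. \<Sum>k\<in>K. c k * f k x) g = (\<Sum>k\<in>K. c k * inner01 (f k) g)"
proof -
  have "inner01 (\<lambda>x. \<Sum>k\<in>K. c k * f k x) g =
      (LINT x|lborel. (\<Sum>k\<in>K. c k * (indicator ({0..1} \<times> {0..1}) x *\<^sub>R (f k x * cnj (g x)))))"
    unfolding inner01_def set_lebesgue_integral_def
    by (intro Bochner_Integration.integral_cong)
      (auto simp: sum_distrib_right scaleR_sum_right mult.assoc)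
  also have "\<dots> = (\<Sum>k\<in>K. c k * inner01 (f k) g)"
    unfolding inner01_def set_lebesgue_integral_def using assms(2)
    by (subst Bochner_Integration.integral_sum)
      (auto simp: set_integrable_def simp del: mult_scaleR_right)
  finally show ?thesis .
qed

text \<open>For these \<open>k\<close> the support of the dilated translate lies inside the unit
  interval, so the integral extends to the whole line. Substituting \<open>y = 2 ^ R * x - k\<close>
  leaves \<open>k\<close> only in a phase, and this makes the interior columns a chirp
  matrix.\<close>

lemma fourier01_interior:
  assumes [measurable]: "phi S \<in> borel_measurable borel"
    and supp: "AE x in lborel. x \<notin> {1 - real a..real a} \<longrightarrow> phi S x = 0"
    and k: "a \<le> k" "k < 2 ^ R - a"
  shows "fourier01 (phi_int a S R k) \<omega> =
    of_real (2 powr (real R / 2) / 2 ^ R) *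
    (LINT y|lborel. of_real (phi S y) * cis (- (2 * pi * \<omega> * y / 2 ^ R))) *
    cis (- (2 * pi * \<omega> / 2 ^ R) * real k)"
proof -
  let ?c = "2 ^ R :: real"
  have k': "real k + real a + 1 \<le> ?c"
  proof -
    have "k + a + 1 \<le> 2 ^ R" using k by simp
    then have "real (k + a + 1) \<le> real (2 ^ R)" by (rule of_nat_mono)
    then show ?thesis by simp
  qed
  \<comment> \<open>The affine substitution acts on the whole line; the cut-off to the unit interval
    is therefore carried along until the support of \<open>phi S\<close> shows that it equals
    1.\<close>
  define G where "G y = indicator {0..1} ((y + real k) / ?c) *\<^sub>R
      (complex_of_real (2 powr (real R / 2) * phi S y) * cnj (fexp \<omega> ((y + real k) / ?c)))" for y
  have "fourier01 (phi_int a S R k) \<omega> = (LINT x|lborel. G (- real k + ?c * x))"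
    unfolding fourier01_def set_lebesgue_integral_def
    by (intro Bochner_Integration.integral_cong) (use k in \<open>auto simp: G_def phi_int_def\<close>)
  also have "\<dots> = (1 / ?c) *\<^sub>R (LINT y|lborel. G y)"
    by (subst lborel_integral_real_affine[of ?c G "- real k"]) auto
  also have "(LINT y|lborel. G y) = (LINT y|lborel.
      (of_real (2 powr (real R / 2)) * cis (- (2 * pi * \<omega> / ?c) * real k)) *
      (of_real (phi S y) * cis (- (2 * pi * \<omega> * y / ?c))))"
  proof (rule integral_cong_AE)
    show "AE y in lborel. G y =
      (of_real (2 powr (real R / 2)) * cis (- (2 * pi * \<omega> / ?c) * real k)) *
      (of_real (phi S y) * cis (- (2 * pi * \<omega> * y / ?c)))"
      using supp
    proof eventually_elim
      case (elim y)
      show ?case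
      proof (cases "y \<in> {1 - real a..real a}")
        case True
        then have y: "0 \<le> (y + real k) / ?c" "(y + real k) / ?c \<le> 1"
          using k k' by (auto simp: field_simps)
        then have "G y = complex_of_real (2 powr (real R / 2) * phi S y) *
            cis (- (2 * pi * \<omega> * ((y + real k) / ?c)))"
          by (simp add: G_def cnj_fexp)
        also have "- (2 * pi * \<omega> * ((y + real k) / ?c)) =
            - (2 * pi * \<omega> / ?c) * real k + - (2 * pi * \<omega> * y / ?c)"
          by (simp add: field_simps)
        finally show ?thesis unfolding cis_mult[symmetric] by simp
      next
        case False
        then show ?thesis using elim by (simp add: G_def)
      qed
    qed
    have "continuous_on UNIV (\<lambda>y. cis (- (2 * pi * \<omega> * y / ?c)))"
      by (intro continuous_intros) auto
    then have [measurable]: "(\<lambda>y. cis (- (2 * pi * \<omega> * y / ?c))) \<in> borel_measurable borel"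
      by (rule borel_measurable_continuous_onI)
    show "(\<lambda>y. (of_real (2 powr (real R / 2)) * cis (- (2 * pi * \<omega> / ?c) * real k)) *
      (of_real (phi S y) * cis (- (2 * pi * \<omega> * y / ?c)))) \<in> borel_measurable lborel"
      by measurable
    show "G \<in> borel_measurable lborel"
      unfolding G_def by measurable
  qed
  finally show ?thesis
    by (simp add: scaleR_conv_of_real)
qed

section \<open>Integrability of the basis functions\<close>

lemma orthonormal_on_integrable01:
  assumes "orthonormal_on {0..1} n f" "k < n" "f k \<in> borel_measurable borel"
  shows "integrable01 (f k)"
proof (rule integrable01_square)
  have "(LINT x:{0..1}|lborel. f k x * f k x) = of_bool (k = k)"
    using assms(1,2) unfolding orthonormal_on_def by blast
  then show "(LINT x:{0..1}|lborel. f k x * f k x) = 1" by simp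
qed (rule assms(3))

text \<open>The right boundary functions are specified through their reflections, so measurability
  has to be carried back.\<close>

lemma measurable_reflect:
  fixes f :: "real \<Rightarrow> real"
  assumes "(\<lambda>x. f (- x)) \<in> borel_measurable borel"
  shows "f \<in> borel_measurable borel"
proof -
  have "(\<lambda>x::real. - x) \<in> borel_measurable borel" by measurable
  from measurable_compose[OF this assms] show ?thesis by (simp only: minus_minus)
qed

text \<open>Covers \<open>phi_int\<close> and \<open>psi_int\<close> together. Boundary functions
  are known to be measurable only for indices below \<open>a\<close>, so the index used in the last
  branch has to be bounded.\<close>

lemma two_scale_measurable:
  fixes f :: "real \<Rightarrow> real"
  assumes [measurable]: "f \<in> borel_measurable borel"
    and "\<And>k. k < a \<Longrightarrow> l k \<in> borel_measurable borel"
    and "\<And>k. k < a \<Longrightarrow> r k \<in> borel_measurable borel"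
    and "k < 2 ^ j"
  shows "(\<lambda>x. 2 powr (real j / 2) *
     (if k < a then l k (2 ^ j * x)
      else if k < 2 ^ j - a then f (2 ^ j * x - real k)
      else r (2 ^ j - k - 1) (2 ^ j * (x - 1)))) \<in> borel_measurable borel"
proof (cases "k < a")
  case True
  with assms(2) have [measurable]: "l k \<in> borel_measurable borel" by blast
  show ?thesis using True by simp
next
  case k: False
  show ?thesis
  proof (cases "k < 2 ^ j - a")
    case True
    then show ?thesis using k by simp
  next
    case False
    define i where "i = 2 ^ j - k - 1"
    have "i < a" using k False assms(4) unfolding i_def by linarith
    with assms(3) have [measurable]: "r i \<in> borel_measurable borel" by blast
    show ?thesis unfolding if_not_P[OF k] if_not_P[OF False] i_def[symmetric] by measurable
  qed
qed

lemma integrable01_phi_psi: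
  assumes S: "cdv_wavelets a S" and j: "2 * a \<le> 2 ^ j" and k: "k < 2 ^ j"
  shows "integrable01 (phi_int a S j k)" and "integrable01 (psi_int a S j k)"
proof -
  have "phi S \<in> borel_measurable borel" "psi S \<in> borel_measurable borel"
    using S by (auto simp: cdv_wavelets_def daubechies_def)
  moreover have "phi0 S k \<in> borel_measurable borel" "psi0 S k \<in> borel_measurable borel"
    if "k < a" for k
    using S that by (auto simp: cdv_wavelets_def left_boundary_def)
  moreover have "phi1 S k \<in> borel_measurable borel" "psi1 S k \<in> borel_measurable borel"
    if "k < a" for k
  proof -
    have "(\<lambda>x. phi1 S k (- x)) \<in> borel_measurable borel"
      "(\<lambda>x. psi1 S k (- x)) \<in> borel_measurable borel"
      using S that by (simp_all add: cdv_wavelets_def left_boundary_def)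
    then show "phi1 S k \<in> borel_measurable borel" "psi1 S k \<in> borel_measurable borel"
      by (simp_all only: measurable_reflect)
  qed
  ultimately have "phi_int a S j k \<in> borel_measurable borel" "psi_int a S j k \<in> borel_measurable borel"
    unfolding phi_int_def[abs_def] psi_int_def[abs_def]
    by (intro two_scale_measurable k; simp)+
  moreover have "orthonormal_on {0..1} (2 ^ j) (phi_int a S j)"
    "orthonormal_on {0..1} (2 ^ j) (psi_int a S j)"
    using S j by (auto simp: cdv_wavelets_def multiresolution_def)
  ultimately show "integrable01 (phi_int a S j k)" "integrable01 (psi_int a S j k)"
    using k by (auto intro: orthonormal_on_integrable01)
qed

section \<open>Refinement by one scale and the block structure of the array\<close>

definition level_fun :: "nat \<Rightarrow> wavelet_system \<Rightarrow> nat \<Rightarrow> nat \<Rightarrow> real \<Rightarrow> real" where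
  "level_fun a S j n = (if n < 2 ^ j then phi_int a S j n else psi_int a S j (n - 2 ^ j))"

lemma integrable01_level_fun:
  assumes "cdv_wavelets a S" "2 * a \<le> 2 ^ j" "n < 2 ^ Suc j"
  shows "integrable01 (level_fun a S j n)"
proof -
  have "n < 2 ^ j \<or> n - 2 ^ j < 2 ^ j" using assms(3) by auto
  then show ?thesis using integrable01_phi_psi[OF assms(1,2)] by (auto simp only: level_fun_def split: if_split)
qed

text \<open>The two-scale relations, valid almost everywhere, become exact identities between
  Fourier coefficients. The filter \<open>h\<close> is chosen before \<omega>, so one sparse matrix
  serves all frequencies.\<close>

lemma fourier01_level_fun:
  assumes S: "cdv_wavelets a S" and j: "2 * a \<le> 2 ^ j"
  obtains h :: "nat \<Rightarrow> nat \<Rightarrow> real" where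
    "\<And>n. n < 2 ^ Suc j \<Longrightarrow> card {l. l < 2 ^ Suc j \<and> h n l \<noteq> 0} \<le> 3 * a"
    "\<And>n \<omega>. n < 2 ^ Suc j \<Longrightarrow> fourier01 (level_fun a S j n) \<omega> =
      (\<Sum>l | l < 2 ^ Suc j \<and> h n l \<noteq> 0. of_real (h n l) * fourier01 (phi_int a S (Suc j) l) \<omega>)"
proof -
  have "\<exists>h :: nat \<Rightarrow> real. card {l. l < 2 ^ Suc j \<and> h l \<noteq> 0} \<le> 3 * a \<and>
      (\<forall>\<omega>. fourier01 (level_fun a S j n) \<omega> =
        (\<Sum>l | l < 2 ^ Suc j \<and> h l \<noteq> 0. of_real (h l) * fourier01 (phi_int a S (Suc j) l) \<omega>))"
    if n: "n < 2 ^ Suc j" for n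
  proof -
    have "multiresolution a S j" using S j by (auto simp: cdv_wavelets_def)
    then have filters: "\<forall>k<2 ^ j.
        filtered_by (phi_int a S j k) (3 * a - 1) (2 ^ Suc j) (phi_int a S (Suc j)) \<and>
        filtered_by (psi_int a S j k) (3 * a - 1) (2 ^ Suc j) (phi_int a S (Suc j))"
      unfolding multiresolution_def by blast
    have "filtered_by (level_fun a S j n) (3 * a - 1) (2 ^ Suc j) (phi_int a S (Suc j))"
    proof (cases "n < 2 ^ j")
      case True
      then show ?thesis unfolding level_fun_def if_P[OF True] using filters by blast
    next
      case False
      then have "n - 2 ^ j < 2 ^ j" using n by simp
      then show ?thesis unfolding level_fun_def if_not_P[OF False] using filters by blast
    qed
    then obtain h where h: "card {l. l < 2 ^ Suc j \<and> h l \<noteq> 0} \<le> 3 * a - 1"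
      "AE x in lborel. x \<in> {0..1} \<longrightarrow>
        level_fun a S j n x = (\<Sum>l<2 ^ Suc j. h l * phi_int a S (Suc j) l x)"
      unfolding filtered_by_def by blast
    have meas: "level_fun a S j n \<in> borel_measurable borel"
      using integrable01_level_fun[OF S j n] by (simp add: integrable01_def)
    have j': "2 * a \<le> 2 ^ Suc j" using j by simp
    have "fourier01 (level_fun a S j n) \<omega> = (\<Sum>l | l < 2 ^ Suc j \<and> h l \<noteq> 0.
        of_real (h l) * fourier01 (phi_int a S (Suc j) l) \<omega>)" for \<omega>
    proof -
      have "fourier01 (level_fun a S j n) \<omega> =
          (\<Sum>l<2 ^ Suc j. of_real (h l) * fourier01 (phi_int a S (Suc j) l) \<omega>)"
        by (rule fourier01_linear_combination[OF meas integrable01_phi_psi(1)[OF S j'] h(2)])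
      also have "\<dots> = (\<Sum>l | l < 2 ^ Suc j \<and> h l \<noteq> 0.
          of_real (h l) * fourier01 (phi_int a S (Suc j) l) \<omega>)"
        by (rule sum.mono_neutral_right) auto
      finally show ?thesis .
    qed
    moreover have "card {l. l < 2 ^ Suc j \<and> h l \<noteq> 0} \<le> 3 * a" using h(1) by linarith
    ultimately show ?thesis by blast
  qed
  then obtain h :: "nat \<Rightarrow> nat \<Rightarrow> real" where
    h: "\<forall>n<2 ^ Suc j. card {l. l < 2 ^ Suc j \<and> h n l \<noteq> 0} \<le> 3 * a \<and>
      (\<forall>\<omega>. fourier01 (level_fun a S j n) \<omega> =
        (\<Sum>l | l < 2 ^ Suc j \<and> h n l \<noteq> 0.
          of_real (h n l) * fourier01 (phi_int a S (Suc j) l) \<omega>))"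
    using choice_iff'[of "\<lambda>n. n < 2 ^ Suc j"] by meson
  show thesis
  proof (rule that[of h])
    fix n :: nat assume n: "n < 2 ^ Suc j"
    show "card {l. l < 2 ^ Suc j \<and> h n l \<noteq> 0} \<le> 3 * a"
      using h[rule_format, OF n] by (rule conjunct1)
    show "fourier01 (level_fun a S j n) \<omega> =
        (\<Sum>l | l < 2 ^ Suc j \<and> h n l \<noteq> 0.
          of_real (h n l) * fourier01 (phi_int a S (Suc j) l) \<omega>)" for \<omega>
      using h[rule_format, OF n] by blast
  qed
qed

text \<open>The four blocks of this square are the four products of low and high halves, so together
  they form a tensor square. This is what makes a wavelet level separable.\<close>

lemma wavelet2d_level:
  assumes "n1 < 2 ^ Suc j" "n2 < 2 ^ Suc j"
  shows "wavelet2d a S j n1 n2 = tensor (level_fun a S j n1) (level_fun a S j n2)"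
proof (cases "max n1 n2 < 2 ^ j")
  case True
  then show ?thesis by (auto simp: wavelet2d_def level_fun_def)
next
  case False
  then have "floor_log (max n1 n2) = j"
    using assms by (intro floor_log_eqI) auto
  then show ?thesis using False by (auto simp: wavelet2d_def level_fun_def)
qed

text \<open>The coarsest scale enters the definition only through the test for the first block.
  Outside the square of side \<open>2 ^ Suc j\<close> this test fails for both scales.\<close>

lemma wavelet2d_eq_Suc:
  assumes "\<not> (n1 < 2 ^ Suc j \<and> n2 < 2 ^ Suc j)"
  shows "wavelet2d a S j n1 n2 = wavelet2d a S (Suc j) n1 n2"
proof -
  have "\<not> max n1 n2 < 2 ^ Suc j" using assms by auto
  moreover from this have "\<not> max n1 n2 < 2 ^ j" by auto
  ultimately show ?thesis unfolding wavelet2d_def by (simp only: if_False)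
qed

lemma wavelet2d_tensor:
  assumes S: "cdv_wavelets a S" and J: "2 * a \<le> 2 ^ J"
  obtains f g where "integrable01 f" "integrable01 g" "wavelet2d a S J n1 n2 = tensor f g"
proof (cases "max n1 n2 < 2 ^ J")
  case True
  then show thesis
    using that[of "phi_int a S J n1" "phi_int a S J n2"] integrable01_phi_psi[OF S J]
    by (auto simp: wavelet2d_def)
next
  case False
  define j where "j = floor_log (max n1 n2)"
  have "max n1 n2 \<noteq> 0" using False by (metis not_less zero_less_numeral zero_less_power gr0I)
  then have j: "2 ^ j \<le> max n1 n2" "max n1 n2 < 2 ^ Suc j"
    unfolding j_def using floor_log_exp2_le[of "max n1 n2"] floor_log_exp2_gt[of "max n1 n2"] by auto
  have "J \<le> j"
    using floor_log_le_iff[of "2 ^ J" "max n1 n2"] False by (simp add: j_def)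
  then have J': "2 * a \<le> 2 ^ j"
    using J power_increasing[of J j "2 :: nat"] by linarith
  \<comment> \<open>Taking the entry's own scale as the coarsest one places it in the square where
    the array is a tensor square.\<close>
  have "wavelet2d a S J n1 n2 = wavelet2d a S j n1 n2"
    using False j by (simp only: wavelet2d_def j_def[symmetric] if_False not_less[symmetric])
  also have "\<dots> = tensor (level_fun a S j n1) (level_fun a S j n2)"
    using j by (intro wavelet2d_level) auto
  finally show thesis
    using that integrable01_level_fun[OF S J'] j(2) by auto
qed


section \<open>The two-dimensional sampling matrix\<close>

text \<open>\<open>A'\<close> is the product of \<open>A\<close> with a sparse matrix
  \<open>E\<close> that recombines the columns in \<open>P\<close> and is the identity on all
  others.\<close>

lemma matrix_cost_columns:
  assumes A: "matrix_cost X Y A b" and "P \<subseteq> X"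
    and K: "\<And>x. x \<in> P \<Longrightarrow> K x \<subseteq> X" "\<And>x. x \<in> P \<Longrightarrow> card (K x) \<le> s"
    and in_P: "\<And>x y. x \<in> P \<Longrightarrow> y \<in> Y \<Longrightarrow> A' y x = (\<Sum>k\<in>K x. A y k * e x k)"
    and out_P: "\<And>x y. x \<in> X - P \<Longrightarrow> y \<in> Y \<Longrightarrow> A' y x = A y x"
  shows "matrix_cost X Y A' (b + 2 * (real s * real (card P) + real (card X)))"
proof -
  have fin: "finite X" using A by (simp add: matrix_cost_def)
  define E where "E k x = (if x \<in> P then if k \<in> K x then e x k else 0 else of_bool (k = x))" for k x
  have "matrix_cost X X E (2 * (\<Sum>x\<in>X. if x \<in> P then real s else 1))"
  proof (rule matrix_cost_sparse)
    fix x assume x: "x \<in> X"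
    show "real (card {k \<in> X. E k x \<noteq> 0}) \<le> (if x \<in> P then real s else 1)"
    proof (cases "x \<in> P")
      case True
      then have "card {k \<in> X. E k x \<noteq> 0} \<le> card (K x)"
        using K(1) fin by (intro card_mono) (auto simp: E_def intro: finite_subset split: if_splits)
      then show ?thesis using True K(2)[OF True] by simp
    next
      case False
      then have "card {k \<in> X. E k x \<noteq> 0} \<le> card {x}"
        by (intro card_mono) (auto simp: E_def)
      then show ?thesis using False by simp
    qed
  qed (use fin in auto)
  then have "matrix_cost X Y (\<lambda>y x. \<Sum>k\<in>X. A y k * E k x)
      (2 * (\<Sum>x\<in>X. if x \<in> P then real s else 1) + b)"
    by (rule matrix_cost_compose[OF _ A])
  then have "matrix_cost X Y A' (2 * (\<Sum>x\<in>X. if x \<in> P then real s else 1) + b)"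
  proof (rule matrix_cost_cong)
    fix x y assume xy: "x \<in> X" "y \<in> Y"
    show "(\<Sum>k\<in>X. A y k * E k x) = A' y x"
    proof (cases "x \<in> P")
      case True
      then have "(\<Sum>k\<in>X. A y k * E k x) = (\<Sum>k\<in>K x. A y k * e x k)"
        using fin K(1)[OF True] by (intro sum.mono_neutral_cong_right) (auto simp: E_def)
      then show ?thesis using in_P True xy by simp
    next
      case False
      then have "(\<Sum>k\<in>X. A y k * E k x) = (\<Sum>k\<in>X. if k = x then A y k else 0)"
        by (intro sum.cong) (auto simp: E_def)
      then show ?thesis using out_P False xy fin by simp
    qed
  qed
  moreover have "(\<Sum>x\<in>X. if x \<in> P then real s else 1) \<le> real s * real (card P) + real (card X)"
  proof -
    have "(\<Sum>x\<in>X. if x \<in> P then real s else 1) = real s * real (card P) + real (card (X - P))"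
      using fin \<open>P \<subseteq> X\<close> by (simp add: sum.If_cases Int_absorb1 Diff_eq)
    moreover have "card (X - P) \<le> card X" using fin by (intro card_mono) auto
    ultimately show ?thesis by simp
  qed
  ultimately show ?thesis by (elim matrix_cost_mono) simp
qed

text \<open>The coarsest scale \<open>j\<close> is a parameter because the induction runs over it:
  on indices below \<open>2 ^ R\<close> the case \<open>j = R\<close> involves scaling functions
  only, and \<open>j = J\<close> is the matrix wanted.\<close>

definition sampling_matrix ::
  "nat \<Rightarrow> wavelet_system \<Rightarrow> real \<Rightarrow> nat \<Rightarrow> int \<times> int \<Rightarrow> nat \<times> nat \<Rightarrow> complex" where
  "sampling_matrix a S \<epsilon> j = (\<lambda>(m1, m2) (n1, n2). of_real \<epsilon> *
     inner01 (\<lambda>x. of_real (wavelet2d a S j n1 n2 x))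
       (tensor (fexp (\<epsilon> * of_int m1)) (fexp (\<epsilon> * of_int m2))))"

lemma sampling_eq_sampling_matrix:
  assumes "cdv_wavelets a S" "2 * a \<le> 2 ^ J"
  shows "sampling a S J N \<epsilon> \<alpha> y = (\<Sum>x\<in>{..<N} \<times> {..<N}. sampling_matrix a S \<epsilon> J y x * \<alpha> x)"
proof (cases y)
  case (Pair m1 m2)
  let ?e = "tensor (fexp (\<epsilon> * of_int m1)) (fexp (\<epsilon> * of_int m2))"
  have int: "set_integrable lborel ({0..1} \<times> {0..1})
      (\<lambda>x. complex_of_real (wavelet2d a S J n1 n2 x) * cnj (?e x))" for n1 n2
    by (rule wavelet2d_tensor[OF assms, of n1 n2]) (simp add: inner01_tensor_fexp(1))
  have "sampling a S J N \<epsilon> \<alpha> y = of_real \<epsilon> * inner01 (\<lambda>x. \<Sum>p\<in>{..<N} \<times> {..<N}.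
      \<alpha> p * (case p of (n1, n2) \<Rightarrow> of_real (wavelet2d a S J n1 n2 x))) ?e"
    by (simp add: sampling_def Pair sum.cartesian_product case_prod_unfold)
  also have "\<dots> = of_real \<epsilon> * (\<Sum>p\<in>{..<N} \<times> {..<N}. \<alpha> p *
      inner01 (\<lambda>x. case p of (n1, n2) \<Rightarrow> of_real (wavelet2d a S J n1 n2 x)) ?e)"
    using int by (subst inner01_sum) auto
  also have "\<dots> = (\<Sum>x\<in>{..<N} \<times> {..<N}. sampling_matrix a S \<epsilon> J y x * \<alpha> x)"
    unfolding sum_distrib_left
    by (intro sum.cong refl) (auto simp: sampling_matrix_def Pair)
  finally show ?thesis .
qed

lemma sampling_matrix_level:
  assumes "cdv_wavelets a S" "2 * a \<le> 2 ^ j" "n1 < 2 ^ Suc j" "n2 < 2 ^ Suc j"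
  shows "sampling_matrix a S \<epsilon> j (m1, m2) (n1, n2) = of_real \<epsilon> *
    (fourier01 (level_fun a S j n1) (\<epsilon> * of_int m1) *
     fourier01 (level_fun a S j n2) (\<epsilon> * of_int m2))"
  using assms unfolding sampling_matrix_def
  by (simp only: prod.case wavelet2d_level inner01_tensor_fexp(2) integrable01_level_fun)

lemma sampling_matrix_finest:
  assumes "cdv_wavelets a S" "2 * a \<le> 2 ^ j" "n1 < 2 ^ j" "n2 < 2 ^ j"
  shows "sampling_matrix a S \<epsilon> j (m1, m2) (n1, n2) = of_real \<epsilon> *
    (fourier01 (phi_int a S j n1) (\<epsilon> * of_int m1) *
     fourier01 (phi_int a S j n2) (\<epsilon> * of_int m2))"
proof -
  have "n1 < 2 ^ Suc j" "n2 < 2 ^ Suc j" using assms(3,4) by simp_all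
  then show ?thesis
    unfolding sampling_matrix_level[OF assms(1,2) \<open>n1 < 2 ^ Suc j\<close> \<open>n2 < 2 ^ Suc j\<close>]
    using assms(3,4) by (simp only: level_fun_def if_True)
qed

text \<open>Two column operations, one per coordinate, pass from scale \<open>Suc j\<close> to
  \<open>j\<close>. Each needs at most \<open>3 * a\<close> entries in the \<open>4 * 4 ^ j\<close>
  affected columns and one in every other, hence costs
  \<open>24 * a * 4 ^ j + 2 * 4 ^ R\<close>.\<close>

lemma matrix_cost_sampling_coarser:
  assumes S: "cdv_wavelets a S" and j: "2 * a \<le> 2 ^ j" and R: "j < R"
    and cost: "matrix_cost ({..<2 ^ R} \<times> {..<2 ^ R}) Y (sampling_matrix a S \<epsilon> (Suc j)) b"
  shows "matrix_cost ({..<2 ^ R} \<times> {..<2 ^ R}) Y (sampling_matrix a S \<epsilon> j)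
    (b + 48 * real a * 4 ^ j + 4 * 4 ^ R)"
proof -
  define n :: nat where "n = 2 ^ Suc j"
  have nR: "n \<le> 2 ^ R" unfolding n_def using R by (intro power_increasing) auto
  have j': "2 * a \<le> 2 ^ Suc j" using j by simp
  obtain h where h: "\<And>k. k < n \<Longrightarrow> card {l. l < n \<and> h k l \<noteq> 0} \<le> 3 * a"
    "\<And>k \<omega>. k < n \<Longrightarrow> fourier01 (level_fun a S j k) \<omega> =
      (\<Sum>l | l < n \<and> h k l \<noteq> 0. of_real (h k l) * fourier01 (phi_int a S (Suc j) l) \<omega>)"
    using fourier01_level_fun[OF S j] unfolding n_def by blast
  let ?P = "{..<n} \<times> {..<n}"
  let ?X = "{..<2 ^ R} \<times> {..<2 ^ R} :: (nat \<times> nat) set"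
  \<comment> \<open>Intermediate stage inside the square: the second coordinate is already split
    into scales \<open>j\<close>, the first still uses scaling functions of scale
    \<open>Suc j\<close>.\<close>
  define H where "H = (\<lambda>(m1, m2) (n1, n2). if n1 < n \<and> n2 < n then of_real \<epsilon> *
    (fourier01 (phi_int a S (Suc j) n1) (\<epsilon> * of_int m1) *
     fourier01 (level_fun a S j n2) (\<epsilon> * of_int m2))
    else sampling_matrix a S \<epsilon> (Suc j) (m1, m2) (n1, n2))"
  have cost_eq: "2 * (real (3 * a) * real (card ?P) + real (card ?X)) = 24 * real a * 4 ^ j + 2 * 4 ^ R"
  proof -
    have pow: "2 ^ i * 2 ^ i = (4 :: real) ^ i" for i by (simp flip: power_mult_distrib)
    have "real (card ?P) = 4 * 4 ^ j" "real (card ?X) = 4 ^ R"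
      using pow[of j] pow[of R] by (simp_all add: card_cartesian_product n_def)
    then show ?thesis by simp
  qed
  have "matrix_cost ?X Y H (b + 2 * (real (3 * a) * real (card ?P) + real (card ?X)))"
  proof (rule matrix_cost_columns[where P = ?P and e = "\<lambda>x k. of_real (h (snd x) (snd k))"
        and K = "\<lambda>x. {fst x} \<times> {l. l < n \<and> h (snd x) l \<noteq> 0}"])
    show "card ({fst x} \<times> {l. l < n \<and> h (snd x) l \<noteq> 0}) \<le> 3 * a" if "x \<in> ?P" for x
      using that h(1) by (auto simp: card_cartesian_product)
    show "H y x = (\<Sum>k\<in>{fst x} \<times> {l. l < n \<and> h (snd x) l \<noteq> 0}.
        sampling_matrix a S \<epsilon> (Suc j) y k * of_real (h (snd x) (snd k)))" if "x \<in> ?P" for x y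
    proof -
      obtain n1 n2 m1 m2 where xy: "x = (n1, n2)" "y = (m1, m2)" by (cases x; cases y) blast
      have n12: "n1 < n" "n2 < n" using that xy by auto
      have "(\<Sum>k\<in>{fst x} \<times> {l. l < n \<and> h (snd x) l \<noteq> 0}.
          sampling_matrix a S \<epsilon> (Suc j) y k * of_real (h (snd x) (snd k))) =
          (\<Sum>l | l < n \<and> h n2 l \<noteq> 0. sampling_matrix a S \<epsilon> (Suc j) (m1, m2) (n1, l) * of_real (h n2 l))"
        unfolding xy by (subst sum.cartesian_product') simp
      also have "\<dots> = (\<Sum>l | l < n \<and> h n2 l \<noteq> 0. of_real \<epsilon> *
          (fourier01 (phi_int a S (Suc j) n1) (\<epsilon> * of_int m1) *
           (of_real (h n2 l) * fourier01 (phi_int a S (Suc j) l) (\<epsilon> * of_int m2))))"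
        using n12 by (intro sum.cong refl)
          (auto simp: sampling_matrix_finest[OF S j'] n_def mult_ac)
      also have "\<dots> = H y x"
        using n12 by (simp add: H_def xy h(2) sum_distrib_left)
      finally show ?thesis by simp
    qed
    show "H y x = sampling_matrix a S \<epsilon> (Suc j) y x" if "x \<in> ?X - ?P" for x y
      using that by (cases x; cases y) (auto simp: H_def)
    show "?P \<subseteq> ?X" using nR by auto
    show "{fst x} \<times> {l. l < n \<and> h (snd x) l \<noteq> 0} \<subseteq> ?X" if "x \<in> ?P" for x
      using that nR by auto
  qed (rule cost)
  then have "matrix_cost ?X Y (sampling_matrix a S \<epsilon> j)
      (b + 2 * (real (3 * a) * real (card ?P) + real (card ?X)) +
       2 * (real (3 * a) * real (card ?P) + real (card ?X)))"
  proof (rule matrix_cost_columns[where P = ?P and e = "\<lambda>x k. of_real (h (fst x) (fst k))"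
        and K = "\<lambda>x. {l. l < n \<and> h (fst x) l \<noteq> 0} \<times> {snd x}"])
    show "card ({l. l < n \<and> h (fst x) l \<noteq> 0} \<times> {snd x}) \<le> 3 * a" if "x \<in> ?P" for x
      using that h(1) by (auto simp: card_cartesian_product)
    show "sampling_matrix a S \<epsilon> j y x = (\<Sum>k\<in>{l. l < n \<and> h (fst x) l \<noteq> 0} \<times> {snd x}.
        H y k * of_real (h (fst x) (fst k)))" if "x \<in> ?P" for x y
    proof -
      obtain n1 n2 m1 m2 where xy: "x = (n1, n2)" "y = (m1, m2)" by (cases x; cases y) blast
      have n12: "n1 < n" "n2 < n" using that xy by auto
      have "(\<Sum>k\<in>{l. l < n \<and> h (fst x) l \<noteq> 0} \<times> {snd x}. H y k * of_real (h (fst x) (fst k))) =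
          (\<Sum>l | l < n \<and> h n1 l \<noteq> 0. H (m1, m2) (l, n2) * of_real (h n1 l))"
        unfolding xy by (subst sum.cartesian_product') simp
      also have "\<dots> = (\<Sum>l | l < n \<and> h n1 l \<noteq> 0. of_real \<epsilon> *
          ((of_real (h n1 l) * fourier01 (phi_int a S (Suc j) l) (\<epsilon> * of_int m1)) *
           fourier01 (level_fun a S j n2) (\<epsilon> * of_int m2)))"
        using n12 by (intro sum.cong refl) (auto simp: H_def mult_ac)
      also have "\<dots> = sampling_matrix a S \<epsilon> j y x"
        unfolding xy sampling_matrix_level[OF S j n12[unfolded n_def]] h(2)[OF n12(1)]
        by (simp add: sum_distrib_left sum_distrib_right)
      finally show ?thesis by simp
    qed
    show "sampling_matrix a S \<epsilon> j y x = H y x" if "x \<in> ?X - ?P" for x y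
      using that wavelet2d_eq_Suc[of "fst x" j "snd x" a S]
      by (auto simp: H_def sampling_matrix_def n_def split: prod.splits)
    show "?P \<subseteq> ?X" using nR by auto
    show "{l. l < n \<and> h (fst x) l \<noteq> 0} \<times> {snd x} \<subseteq> ?X" if "x \<in> ?P" for x
      using that nR by auto
  qed
  then show ?thesis
    unfolding cost_eq by (rule matrix_cost_mono) simp
qed

text \<open>The matrix is a chirp matrix plus a correction \<open>D\<close> supported in the at most
  \<open>2 * a\<close> boundary columns, which are treated as dense. The scalar \<open>c\<close>
  lets one of the two tensor factors carry \<epsilon>.\<close>

lemma matrix_cost_fourier01:
  assumes S: "cdv_wavelets a S" and a: "1 \<le> a" and RM: "2 ^ R \<le> M"
  shows "matrix_cost {..<2 ^ R} (freqs M) (\<lambda>m k. c * fourier01 (phi_int a S R k) (\<epsilon> * of_int m))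
    ((32 * real R + 64 + 8 * real a) * real M)"
proof -
  let ?N = "2 ^ R :: nat"
  have M: "1 \<le> M" using RM by (metis le_trans one_le_numeral one_le_power)
  have meas: "phi S \<in> borel_measurable borel"
    and "AE x in lborel. x \<notin> {1 - real a..real a} \<longrightarrow> phi S x = 0 \<and> psi S x = 0"
    using S by (auto simp: cdv_wavelets_def daubechies_def)
  then have supp: "AE x in lborel. x \<notin> {1 - real a..real a} \<longrightarrow> phi S x = 0" by auto
  define g :: "int \<Rightarrow> complex" where "g m = c * (of_real (2 powr (real R / 2) / 2 ^ R) *
    (LINT y|lborel. of_real (phi S y) * cis (- (2 * pi * (\<epsilon> * of_int m) * y / 2 ^ R))))" for m
  define \<theta> where "\<theta> = - (2 * pi * \<epsilon> / 2 ^ R)"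
  define D :: "int \<Rightarrow> nat \<Rightarrow> complex" where "D m k =
    c * fourier01 (phi_int a S R k) (\<epsilon> * of_int m) - g m * cis (\<theta> * of_int m * real k)" for m k
  define P where "P = {k. k < ?N \<and> (k < a \<or> ?N - a \<le> k)}"
  have D0: "D m k = 0" if "k < ?N" "k \<notin> P" for m k
    unfolding D_def g_def \<theta>_def using that
    by (subst fourier01_interior[OF meas supp]) (auto simp: P_def field_simps)
  have cardP: "card P \<le> 2 * a"
  proof -
    have "card P \<le> card ({..<a} \<union> {?N - a..<?N})"
      by (intro card_mono) (auto simp: P_def)
    also have "\<dots> \<le> a + a"
      by (rule order_trans[OF card_Un_le]) simp
    finally show ?thesis by simp
  qed
  have "matrix_cost {..<?N} (freqs M) D (2 * (\<Sum>k\<in>{..<?N}. if k \<in> P then 2 * real M else 0))"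
  proof (rule matrix_cost_sparse)
    fix k assume k: "k \<in> {..<?N}"
    have "real (card {m \<in> freqs M. D m k \<noteq> 0}) \<le> real (card (freqs M))"
      by (intro of_nat_mono card_mono) auto
    also have "\<dots> \<le> 2 * real M" by (rule card_freqs_le[OF M])
    finally show "real (card {m \<in> freqs M. D m k \<noteq> 0}) \<le> (if k \<in> P then 2 * real M else 0)"
      using D0 k by auto
  qed auto
  moreover have "(\<Sum>k\<in>{..<?N}. if k \<in> P then 2 * real M else 0) = real (card P) * (2 * real M)"
  proof -
    have "{..<?N} \<inter> P = P" by (auto simp: P_def)
    then show ?thesis by (simp add: sum.If_cases)
  qed
  moreover have "real (card P) * (2 * real M) \<le> (2 * real a) * (2 * real M)"
    using cardP by (intro mult_right_mono) auto
  ultimately have D: "matrix_cost {..<?N} (freqs M) D (8 * real a * real M)"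
    by (elim matrix_cost_mono) simp
  have sum: "matrix_cost {..<?N} (freqs M) (\<lambda>m k. g m * cis (\<theta> * of_int m * real k) + D m k)
      ((32 * real R + 52) * real M + 8 * real a * real M +
       4 * (real (card {..<?N}) + real (card (freqs M))))"
    by (intro matrix_cost_add matrix_cost_chirp RM D)
  \<comment> \<open>Adding the correction costs four times this sum, at most \<open>12 * M\<close>,
    which raises the constant 52 to 64.\<close>
  have "real (card {..<?N}) + real (card (freqs M)) \<le> real M + 2 * real M"
    using card_freqs_le[OF M] RM by (intro add_mono) (simp_all only: card_lessThan of_nat_le_iff)
  then have "(32 * real R + 52) * real M + 8 * real a * real M +
      4 * (real (card {..<?N}) + real (card (freqs M))) \<le> (32 * real R + 64 + 8 * real a) * real M"
    by (simp add: distrib_right)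
  from matrix_cost_mono[OF sum this]
  show ?thesis by (simp add: D_def)
qed

lemma matrix_cost_sampling_finest:
  assumes S: "cdv_wavelets a S" and a: "1 \<le> a" "2 * a \<le> 2 ^ R" and RM: "2 ^ R \<le> M"
  shows "matrix_cost ({..<2 ^ R} \<times> {..<2 ^ R}) (freqs M \<times> freqs M) (sampling_matrix a S \<epsilon> R)
    ((96 * real R + 192 + 24 * real a) * (real M)\<^sup>2)"
proof -
  let ?N = "2 ^ R :: nat" and ?c = "(32 * real R + 64 + 8 * real a) * real M"
  have M: "1 \<le> M" using RM by (metis le_trans one_le_numeral one_le_power)
  \<comment> \<open>The scalar \<epsilon> goes into the first factor; the explicit 1 gives the
    second the shape of \<open>matrix_cost_fourier01\<close>.\<close>
  have "matrix_cost ({..<?N} \<times> {..<?N}) (freqs M \<times> freqs M)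
    (\<lambda>(m1, m2) (k1, k2). of_real \<epsilon> * fourier01 (phi_int a S R k1) (\<epsilon> * of_int m1) *
       (1 * fourier01 (phi_int a S R k2) (\<epsilon> * of_int m2)))
    (real (card {..<?N}) * ?c + real (card (freqs M)) * ?c)"
    by (intro matrix_cost_tensor matrix_cost_fourier01 assms)
  then have "matrix_cost ({..<?N} \<times> {..<?N}) (freqs M \<times> freqs M) (sampling_matrix a S \<epsilon> R)
    (real (card {..<?N}) * ?c + real (card (freqs M)) * ?c)"
    by (rule matrix_cost_cong) (use sampling_matrix_finest[OF S a(2)] in auto)
  moreover have "real (card {..<?N}) * ?c + real (card (freqs M)) * ?c \<le>
      (96 * real R + 192 + 24 * real a) * (real M)\<^sup>2"
  proof -
    have "real (card {..<?N}) * ?c + real (card (freqs M)) * ?c \<le> real M * ?c + (2 * real M) * ?c"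
      using card_freqs_le[OF M] RM
      by (intro add_mono mult_right_mono) (simp_all only: card_lessThan of_nat_le_iff, simp_all)
    also have "\<dots> = (96 * real R + 192 + 24 * real a) * (real M)\<^sup>2"
      by (simp add: algebra_simps power2_eq_square)
    finally show ?thesis .
  qed
  ultimately show ?thesis by (rule matrix_cost_mono)
qed

section \<open>Assembly over all scales and the final bound\<close>

lemma matrix_cost_sampling:
  assumes S: "cdv_wavelets a S" and a: "1 \<le> a" "2 * a \<le> 2 ^ J" and J: "J \<le> R" and RM: "2 ^ R \<le> M"
  shows "matrix_cost ({..<2 ^ R} \<times> {..<2 ^ R}) (freqs M \<times> freqs M) (sampling_matrix a S \<epsilon> J)
    ((100 * real R + 192 + 40 * real a) * (real M)\<^sup>2)"
proof -
  let ?X = "{..<2 ^ R} \<times> {..<2 ^ R} :: (nat \<times> nat) set" and ?Y = "freqs M \<times> freqs M"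
  let ?b = "(96 * real R + 192 + 24 * real a) * (real M)\<^sup>2"
  have pow: "2 * a \<le> 2 ^ j" if "J \<le> j" for j
    using a(2) power_increasing[OF that, of "2 :: nat"] by linarith
  \<comment> \<open>Descending from \<open>R\<close> to \<open>J\<close> sums
    \<open>48 * a * 4 ^ j + 4 * 4 ^ R\<close> over the scales passed; the geometric series turns 48
    into 16.\<close>
  have "matrix_cost ?X ?Y (sampling_matrix a S \<epsilon> J)
      (?b + 4 * 4 ^ R * (real R - real J) + 16 * real a * (4 ^ R - 4 ^ J))"
    using J
  proof (induction rule: inc_induct)
    case base
    then show ?case using matrix_cost_sampling_finest[OF S a(1) pow[OF J] RM] by simp
  next
    case (step j)
    show ?case
      using matrix_cost_sampling_coarser[OF S pow[OF step(1)] step(2) step(3)]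
      by (rule matrix_cost_mono) (simp add: algebra_simps)
  qed
  moreover have "?b + 4 * 4 ^ R * (real R - real J) + 16 * real a * (4 ^ R - 4 ^ J) \<le>
      (100 * real R + 192 + 40 * real a) * (real M)\<^sup>2"
  proof -
    have "(4 :: real) ^ R = (real (2 ^ R))\<^sup>2" by (simp add: power2_eq_square flip: power_mult_distrib)
    also have "\<dots> \<le> (real M)\<^sup>2" using RM by (intro power_mono of_nat_mono) auto
    finally have le: "(4 :: real) ^ R \<le> (real M)\<^sup>2" .
    have "4 * 4 ^ R * (real R - real J) \<le> 4 * (real M)\<^sup>2 * real R"
      using le J by (intro mult_mono) auto
    moreover have "16 * real a * (4 ^ R - 4 ^ J) \<le> 16 * real a * (real M)\<^sup>2"
      using le by (intro mult_left_mono) (auto intro: order_trans[of _ "4 ^ R"])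
    ultimately show ?thesis by (simp add: algebra_simps)
  qed
  ultimately show ?thesis by (rule matrix_cost_mono)
qed

lemma matrix_cost_computable_within:
  assumes A: "matrix_cost X Y A b" and F: "\<And>\<alpha> y. y \<in> Y \<Longrightarrow> F \<alpha> y = (\<Sum>x\<in>X. A y x * \<alpha> x)"
  shows "computable_within X Y F b" and "computable_within Y X (adjoint_map Y F) b"
proof -
  have fin: "finite X" using A by (simp add: matrix_cost_def)
  have "linear_forms X Y A = (\<lambda>y \<alpha>. F \<alpha> y) ` Y"
    unfolding linear_forms_def using F by (intro image_cong refl ext) simp
  then show "computable_within X Y F b"
    using A by (intro computable_withinI) (simp add: matrix_cost_def)
  \<comment> \<open>\<open>adjoint_map\<close> reads the matrix off the images of unit arrays, so
    these have to be identified with the entries of \<open>A\<close>.\<close>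
  have "F (\<lambda>i'. of_bool (i' = x)) y = A y x" if "x \<in> X" "y \<in> Y" for x y
  proof -
    have "F (\<lambda>i'. of_bool (i' = x)) y = (\<Sum>i\<in>X. if i = x then A y i else 0)"
      unfolding F[OF that(2)] by (intro sum.cong) auto
    then show ?thesis using fin that by simp
  qed
  then have "linear_forms Y X (adjoint A) = (\<lambda>x \<zeta>. adjoint_map Y F \<zeta> x) ` X"
    unfolding linear_forms_def adjoint_map_def adjoint_def
    by (intro image_cong refl ext sum.cong) auto
  then show "computable_within Y X (adjoint_map Y F) b"
    using A by (intro computable_withinI) (simp add: matrix_cost_def)
qed

theorem mainTheorem2:
  shows "\<exists>C>0. \<forall>(a::nat) (J::nat) (R::nat) (N::nat) (M::nat) (\<epsilon>::real) (S::wavelet_system).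
    1 \<le> a \<and> J < R \<and> log 2 (2 * real a) \<le> real J \<and> N = 2 ^ R \<and> N \<le> M \<and> 0 < \<epsilon> \<and> \<epsilon> \<le> 1 \<and>
    cdv_wavelets a S \<longrightarrow>
      computable_within ({..<N} \<times> {..<N}) (freqs M \<times> freqs M) (sampling a S J N \<epsilon>)
        (C * (real a * real M ^ 2 + real M ^ 2 * ln (real N / \<epsilon>))) \<and>
      computable_within (freqs M \<times> freqs M) ({..<N} \<times> {..<N})
        (adjoint_map (freqs M \<times> freqs M) (sampling a S J N \<epsilon>))
        (C * (real a * real M ^ 2 + real M ^ 2 * ln (real N / \<epsilon>)))"
proof (intro exI[of _ 600] conjI allI impI; (elim conjE)?)
  show "(600 :: real) > 0" by simp
  fix a J R N M :: nat and \<epsilon> :: real and S :: wavelet_system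
  assume a: "1 \<le> a" and JR: "J < R" and J: "log 2 (2 * real a) \<le> real J" and N: "N = 2 ^ R"
    and NM: "N \<le> M" and \<epsilon>: "0 < \<epsilon>" "\<epsilon> \<le> 1" and S: "cdv_wavelets a S"
  have "2 * real a \<le> 2 powr real J"
    using J a by (subst (asm) log_le_iff) auto
  then have "real (2 * a) \<le> real (2 ^ J)" by (simp add: powr_realpow)
  then have aJ: "2 * a \<le> 2 ^ J" by (simp only: of_nat_le_iff)
  let ?b = "600 * (real a * real M ^ 2 + real M ^ 2 * ln (real N / \<epsilon>))"
  have "real R / 2 \<le> real R * ln 2"
    using mult_left_mono[OF ln2_ge_two_thirds, of "real R"] by simp
  also have "\<dots> = ln (real N)" by (simp add: N ln_realpow)
  also have "\<dots> \<le> ln (real N / \<epsilon>)"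
    using \<epsilon> by (subst ln_le_cancel_iff) (auto simp: N field_simps)
  finally have R: "real R \<le> 2 * ln (real N / \<epsilon>)" by simp
  \<comment> \<open>\<open>J < R\<close> gives \<open>R\<close> at least 1, so 192 is absorbed into
    \<open>200 * R\<close>. Then \<open>R\<close> is at most twice the logarithm, which doubles 300
    to the constant 600.\<close>
  have "100 * real R + 192 + 40 * real a \<le> 300 * real R + 40 * real a" using JR by linarith
  also have "\<dots> \<le> 600 * (real a + ln (real N / \<epsilon>))" using R by simp
  finally have "(100 * real R + 192 + 40 * real a) * (real M)\<^sup>2 \<le>
      600 * (real a + ln (real N / \<epsilon>)) * (real M)\<^sup>2"
    by (rule mult_right_mono) simp
  then have "(100 * real R + 192 + 40 * real a) * (real M)\<^sup>2 \<le> ?b"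
    by (simp add: algebra_simps)
  then have cost: "matrix_cost ({..<N} \<times> {..<N}) (freqs M \<times> freqs M) (sampling_matrix a S \<epsilon> J) ?b"
    using matrix_cost_sampling[OF S a aJ less_imp_le[OF JR] NM[unfolded N]] unfolding N
    by (rule matrix_cost_mono[rotated])
  show "computable_within ({..<N} \<times> {..<N}) (freqs M \<times> freqs M) (sampling a S J N \<epsilon>) ?b"
    "computable_within (freqs M \<times> freqs M) ({..<N} \<times> {..<N})
      (adjoint_map (freqs M \<times> freqs M) (sampling a S J N \<epsilon>)) ?b"
    using matrix_cost_computable_within[OF cost] sampling_eq_sampling_matrix[OF S aJ] by blast+
qed

end
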